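(* Let $a\in[0,1]$, let $m=n^{\alpha}$ with a constant $\alpha\ge 3$, and let $\mathcal A$ be a monotone graph property. Let $p=p(n)$ satisfy $$\Omega\!\left(\frac{1}{n\sqrt[3]{m}}\right)=p=O\!\left(\sqrt{\frac{\ln n}{m}}\right),$$ and, in the case $\alpha=3$, additionally $\frac{1}{n\sqrt[3]{m}}=o(p)$. Put $q_2=1-\exp(-mp^2(1-p)^{n-2})$. If $\Pr\{G(n,q_2)\in\mathcal A\}\to a$ and, for every sequence $\varepsilon=\varepsilon(n)\to0$, $\Pr\{G(n,(1+\varepsilon)q_2)\in\mathcal A\}\to a$, then $\Pr\{\mathcal G(n,m,p)\in\mathcal A\}\to a$.
   Context: $G(n,p)$ denotes the binomial random graph on an $n$-element vertex set, each edge present independently with probability $p$. The random intersection graph $\mathcal G(n,m,p)$: vertex set $\mathcal V$, $|\mathcal V|=n$, object set $\mathcal W$, $|\mathcal W|=m$; each vertex $v$ receives $W(v)\subseteq\mathcal W$ with the events $w\in W(v)$ independent of probability $p$ for all $(v,w)$; $v_1\ne v_2$ are adjacent iff $W(v_1)\cap W(v_2)\ne\emptyset$. A graph property $\mathcal A$ (a family of graphs on the vertex set, closed under isomorphism) is increasing if $G\in\mathcal A$ and $E(G)\subseteq E(G')$ imply $G'\in\mathcal A$, decreasing if $G\in\mathcal A$ and $E(G')\subseteq E(G)$ imply $G'\in\mathcal A$; it is monotone if it is increasing or decreasing. All limits are as $n\to\infty$. *)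

theory Defs
  imports "HOL-Analysis.Analysis" "HOL-Library.Landau_Symbols" "HOL-Combinatorics.Permutations"
begin

text \<open>Graphs on the vertex set {0..<n} are represented by their edge sets:
  an edge is a two-element set of vertices.\<close>

definition all_edges :: "nat \<Rightarrow> nat set set" where
  "all_edges n = {e. \<exists>i j. i < n \<and> j < n \<and> i \<noteq> j \<and> e = {i, j}}"

definition graph_property :: "(nat \<Rightarrow> nat set set set) \<Rightarrow> bool" where
  "graph_property A \<longleftrightarrow>
     (\<forall>n. A n \<subseteq> Pow (all_edges n)) \<and>
     (\<forall>n \<pi> G. \<pi> permutes {0..<n} \<longrightarrow> G \<in> A n \<longrightarrow> (\<lambda>e. \<pi> ` e) ` G \<in> A n)"

definition increasing_property :: "(nat \<Rightarrow> nat set set set) \<Rightarrow> bool" where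
  "increasing_property A \<longleftrightarrow>
     (\<forall>n G G'. G \<in> A n \<longrightarrow> G \<subseteq> G' \<longrightarrow> G' \<subseteq> all_edges n \<longrightarrow> G' \<in> A n)"

definition decreasing_property :: "(nat \<Rightarrow> nat set set set) \<Rightarrow> bool" where
  "decreasing_property A \<longleftrightarrow>
     (\<forall>n G G'. G \<in> A n \<longrightarrow> G' \<subseteq> G \<longrightarrow> G' \<in> A n)"

definition monotone_property :: "(nat \<Rightarrow> nat set set set) \<Rightarrow> bool" where
  "monotone_property A \<longleftrightarrow> graph_property A \<and> (increasing_property A \<or> decreasing_property A)"

definition gnp_prob :: "nat \<Rightarrow> real \<Rightarrow> nat set set set \<Rightarrow> real" where
  "gnp_prob n p P =
     (let r = max 0 (min 1 p) in
      \<Sum>E \<in> Pow (all_edges n).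
        (if E \<in> P then r ^ card E * (1 - r) ^ (card (all_edges n) - card E) else 0))"

text \<open>The random intersection graph: S \<subseteq> V \<times> W is the set of pairs (v,w) with w \<in> W(v).\<close>
definition intersection_graph :: "nat \<Rightarrow> nat \<Rightarrow> (nat \<times> nat) set \<Rightarrow> nat set set" where
  "intersection_graph n m S =
     {e. \<exists>u v. u < n \<and> v < n \<and> u \<noteq> v \<and> e = {u, v} \<and>
            (\<exists>w < m. (u, w) \<in> S \<and> (v, w) \<in> S)}"

definition rig_prob :: "nat \<Rightarrow> nat \<Rightarrow> real \<Rightarrow> nat set set set \<Rightarrow> real" where
  "rig_prob n m p P =
     (\<Sum>S \<in> Pow ({0..<n} \<times> {0..<m}).
        (if intersection_graph n m S \<in> P
         then p ^ card S * (1 - p) ^ (n * m - card S) else 0))"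

end

theory Submission
  imports Defs "HOL-Real_Asymp.Real_Asymp"
begin

text \<open>Let \<open>A\<close> be increasing (for a decreasing property pass to the complement). The objects chosen by
  exactly two vertices alone dominate \<open>G(n, (1 - 1/n) q\<^sub>2)\<close>: revealing the edges one at a time, each
  edge already found uses up at most one of the \<open>m \<ge> n\<^sup>3\<close> objects.

  Conversely, one object is dominated by independent cliques on the vertex sets \<open>S\<close> with
  \<open>2 \<le> |S| \<le> K\<close>, up to the event that more than \<open>K\<close> vertices choose it. Reveal the edges of the union of
  these cliques one at a time. If \<open>F\<close> is the set of edges found so far, the probability that a given
  \<open>S\<close> is present is at most its prior probability divided by \<open>q\<close> to the number of edges of \<open>S\<close> in
  \<open>F\<close>, since these edges could be covered by pairs instead. As long as the codegrees in \<open>F\<close> are not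
  large, the sum of these bounds over \<open>|S| \<ge> 3\<close> is \<open>o(q\<^sub>2)\<close>, so that the next edge is present
  with probability at most \<open>(1 + \<epsilon>) q\<^sub>2\<close>. Large codegrees form an increasing event, so it is enough
  that they are unlikely in \<open>G(n, (1 + \<epsilon>) q\<^sub>2)\<close>.\<close>

subsection \<open>Product Bernoulli measures\<close>

text \<open>The bounds on \<open>p\<close> enter through one ratio. A given triangle arises from a
  single object at cost about m p^3 and from three pairs at cost about (m p^2)^3 when m p^2 is
  small; the quotient is the cube of 1 / (m^(2/3) p). The lower bound on \<open>p\<close> makes it
  vanish if \<alpha> > 3, and for \<alpha> = 3 the extra assumption does. The upper bound on
  \<open>p\<close> gives n p \<rightarrow> 0. The obstacle is the posterior weight of a clique,
  which grows by a factor 1 / q with every known edge; some histories admit no useful bound.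
  Therefore the comparison is run on the indicator of "in \<open>A\<close> or some codegree is
  large". Once a codegree is large this function is 1 and stays 1, so nothing has to be known about
  the next edge. To exploit this, the one-step hypothesis of the comparison is a product of a
  probability gap and an increment of the function: it holds for free where the increment is 0, and
  with reversed signs it also serves the lower bound. The upper bound is proved for a fixed loss
  \<epsilon>; a diagonal choice then yields a sequence tending to 0, to which the hypothesis on
  perturbed edge probabilities applies.\<close>

definition bern :: "('a \<Rightarrow> real) \<Rightarrow> 'a set \<Rightarrow> ('a set \<Rightarrow> real) \<Rightarrow> real" where
  "bern r X f = (\<Sum>E\<in>Pow X. (\<Prod>x\<in>E. r x) * (\<Prod>x\<in>X - E. 1 - r x) * f E)"

lemma bern_empty [simp]: "bern r {} f = f {}"
  by (simp add: bern_def)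

text \<open>Conditioning on one coordinate; this is the recursion behind the inductions on the
  ground set. As \<open>bern\<close> is a finite real sum, such identities hold for arbitrary
  \<open>r\<close>, and only inequalities ask for values in [0,1].\<close>

lemma bern_insert:
  assumes "finite X" "x \<notin> X"
  shows "bern r (insert x X) f = r x * bern r X (\<lambda>E. f (insert x E)) + (1 - r x) * bern r X f"
proof -
  have inj: "inj_on (insert x) (Pow X)"
    using assms by (auto simp: inj_on_def)
  have disj: "Pow X \<inter> insert x ` Pow X = {}"
    using assms by auto
  have 1: "(\<Prod>y\<in>insert x E. r y) * (\<Prod>y\<in>insert x X - insert x E. 1 - r y) * f (insert x E)
      = r x * ((\<Prod>y\<in>E. r y) * (\<Prod>y\<in>X - E. 1 - r y) * f (insert x E))" if "E \<in> Pow X" for E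
  proof -
    have "finite E" "x \<notin> E" "insert x X - insert x E = X - E"
      using that assms by (auto intro: finite_subset)
    then show ?thesis by (simp add: mult_ac)
  qed
  have 2: "(\<Prod>y\<in>E. r y) * (\<Prod>y\<in>insert x X - E. 1 - r y) * f E
      = (1 - r x) * ((\<Prod>y\<in>E. r y) * (\<Prod>y\<in>X - E. 1 - r y) * f E)" if "E \<in> Pow X" for E
  proof -
    have "insert x X - E = insert x (X - E)" "x \<notin> X - E" "finite (X - E)"
      using that assms by auto
    then show ?thesis by (simp add: mult_ac)
  qed
  have "bern r (insert x X) f
      = (\<Sum>E\<in>Pow X. (\<Prod>y\<in>E. r y) * (\<Prod>y\<in>insert x X - E. 1 - r y) * f E)
      + (\<Sum>E\<in>Pow X. (\<Prod>y\<in>insert x E. r y) * (\<Prod>y\<in>insert x X - insert x E. 1 - r y) * f (insert x E))"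
    unfolding bern_def Pow_insert using assms disj
    by (subst sum.union_disjoint) (simp_all add: sum.reindex[OF inj] o_def)
  also have "(\<Sum>E\<in>Pow X. (\<Prod>y\<in>E. r y) * (\<Prod>y\<in>insert x X - E. 1 - r y) * f E) = (1 - r x) * bern r X f"
    unfolding bern_def sum_distrib_left by (rule sum.cong[OF refl 2])
  also have "(\<Sum>E\<in>Pow X. (\<Prod>y\<in>insert x E. r y) * (\<Prod>y\<in>insert x X - insert x E. 1 - r y) * f (insert x E))
      = r x * bern r X (\<lambda>E. f (insert x E))"
    unfolding bern_def sum_distrib_left by (rule sum.cong[OF refl 1])
  finally show ?thesis by simp
qed

lemma bern_cong:
  assumes "\<And>E. E \<subseteq> X \<Longrightarrow> f E = g E"
  shows "bern r X f = bern r X g"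
  unfolding bern_def using assms by (intro sum.cong) auto

lemma bern_add: "bern r X (\<lambda>E. f E + g E) = bern r X f + bern r X g"
  by (simp add: bern_def algebra_simps sum.distrib)

lemma bern_cmult: "bern r X (\<lambda>E. c * f E) = c * bern r X f"
  by (simp add: bern_def sum_distrib_left mult_ac)

lemma bern_diff: "bern r X (\<lambda>E. f E - g E) = bern r X f - bern r X g"
  by (simp add: bern_def algebra_simps sum_subtractf)

lemma bern_uminus: "bern r X (\<lambda>E. - f E) = - bern r X f"
  by (simp add: bern_def sum_negf)

lemma bern_sum: "bern r X (\<lambda>E. \<Sum>i\<in>I. f i E) = (\<Sum>i\<in>I. bern r X (f i))"
  unfolding bern_def by (simp add: sum_distrib_left sum.swap[of _ "Pow X"])

lemma bern_const [simp]: "finite X \<Longrightarrow> bern r X (\<lambda>_. c) = c"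
  by (induction X rule: finite_induct) (simp_all add: bern_insert algebra_simps)

lemma bern_mono:
  assumes "\<And>x. x \<in> X \<Longrightarrow> 0 \<le> r x \<and> r x \<le> 1" "\<And>E. E \<subseteq> X \<Longrightarrow> f E \<le> g E"
  shows "bern r X f \<le> bern r X g"
  unfolding bern_def using assms
  by (intro sum_mono mult_left_mono mult_nonneg_nonneg prod_nonneg) auto

lemma bern_nonneg:
  assumes "\<And>x. x \<in> X \<Longrightarrow> 0 \<le> r x \<and> r x \<le> 1" "\<And>E. E \<subseteq> X \<Longrightarrow> 0 \<le> f E"
  shows "0 \<le> bern r X f"
  unfolding bern_def using assms
  by (intro sum_nonneg mult_nonneg_nonneg prod_nonneg) auto

lemma bern_le_1:
  assumes "finite X" "\<And>x. x \<in> X \<Longrightarrow> 0 \<le> r x \<and> r x \<le> 1" "\<And>E. E \<subseteq> X \<Longrightarrow> f E \<le> 1"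
  shows "bern r X f \<le> 1"
  using bern_mono[of X r f "\<lambda>_. 1"] assms by simp

lemma bern_Un:
  assumes "finite X" "finite Y" "X \<inter> Y = {}"
  shows "bern r (X \<union> Y) f = bern r X (\<lambda>E. bern r Y (\<lambda>E'. f (E \<union> E')))"
  using assms
proof (induction X arbitrary: f rule: finite_induct)
  case (insert x X)
  then show ?case
    by (simp add: bern_insert)
qed simp

lemma bern_image:
  assumes "finite X" "inj_on g X"
  shows "bern r (g ` X) f = bern (\<lambda>x. r (g x)) X (\<lambda>E. f (g ` E))"
  using assms
proof (induction X arbitrary: f rule: finite_induct)
  case (insert x X)
  then show ?case
    by (auto simp: bern_insert)
qed simp

text \<open>A point is missing from the union iff both independent draws miss it, hence the product
  of complements. This merges the contributions of successive objects into one product law.\<close>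

lemma bern_bern_Un:
  assumes "finite X"
  shows "bern r X (\<lambda>E. bern s X (\<lambda>E'. f (E \<union> E'))) = bern (\<lambda>x. 1 - (1 - r x) * (1 - s x)) X f"
  using assms
proof (induction X arbitrary: f rule: finite_induct)
  case (insert x X)
  have *: "bern r X (\<lambda>E. bern s (insert x X) (\<lambda>E'. f (E \<union> E')))
     = s x * bern r X (\<lambda>E. bern s X (\<lambda>E'. f (insert x (E \<union> E'))))
      + (1 - s x) * bern r X (\<lambda>E. bern s X (\<lambda>E'. f (E \<union> E')))"
    using insert.hyps by (simp add: bern_insert bern_add bern_cmult)
  have **: "bern r X (\<lambda>E. bern s (insert x X) (\<lambda>E'. f (insert x E \<union> E')))
     = bern r X (\<lambda>E. bern s X (\<lambda>E'. f (insert x (E \<union> E'))))"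
    using insert.hyps by (simp add: bern_insert bern_add bern_cmult algebra_simps)
  show ?case
    using insert.hyps unfolding bern_insert[OF insert.hyps, of r] * **
    by (simp add: bern_insert insert.IH algebra_simps insert.IH[of "\<lambda>E. f (insert x E)"])
qed simp

lemma bern_mem:
  assumes "finite X" "x \<in> X"
  shows "bern r X (\<lambda>J. of_bool (x \<in> J) * f J) = r x * bern r X (\<lambda>J. f (insert x J))"
proof -
  define Y where "Y = X - {x}"
  have X: "X = insert x Y" "x \<notin> Y" "finite Y"
    using assms by (auto simp: Y_def)
  have "bern r Y (\<lambda>J. of_bool (x \<in> J) * f J) = bern r Y (\<lambda>_. 0)"
    by (rule bern_cong) (use X in auto)
  then show ?thesis
    using X by (simp add: bern_insert algebra_simps)
qed

text \<open>Under the condition \<open>Q \<subseteq> J\<close> the other coordinates keep their law,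
  so \<open>J\<close> behaves like an unconditioned set with \<open>Q\<close> added. Read from right
  to left, it prices the forced insertion of \<open>Q\<close>.\<close>

lemma bern_superset:
  assumes "finite X" "Q \<subseteq> X"
  shows "bern r X (\<lambda>J. of_bool (Q \<subseteq> J) * f J) = (\<Prod>x\<in>Q. r x) * bern r X (\<lambda>J. f (J \<union> Q))"
proof -
  have "finite Q" using assms finite_subset by auto
  then show ?thesis using assms(2)
  proof (induction Q arbitrary: f rule: finite_induct)
    case (insert x Q)
    have "bern r X (\<lambda>J. of_bool (insert x Q \<subseteq> J) * f J)
        = bern r X (\<lambda>J. of_bool (Q \<subseteq> J) * (of_bool (x \<in> J) * f J))"
      by (rule bern_cong) auto
    also have "\<dots> = (\<Prod>x\<in>Q. r x) * bern r X (\<lambda>J. of_bool (x \<in> J) * f (J \<union> Q))"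
      using insert by (subst insert.IH) (auto intro!: arg_cong2[of _ _ _ _ "(*)"] bern_cong)
    also have "\<dots> = (\<Prod>x\<in>insert x Q. r x) * bern r X (\<lambda>J. f (J \<union> insert x Q))"
      using insert assms by (subst bern_mem) auto
    finally show ?case .
  qed simp
qed

lemma bern_mono_prob:
  assumes "finite X" "\<And>x. x \<in> X \<Longrightarrow> 0 \<le> r x \<and> r x \<le> s x \<and> s x \<le> 1"
    and "\<And>E E'. E \<subseteq> E' \<Longrightarrow> E' \<subseteq> X \<Longrightarrow> f E \<le> f E'"
  shows "bern r X f \<le> bern s X f"
  using assms
proof (induction X arbitrary: f rule: finite_induct)
  case (insert x X)
  have mono: "f E \<le> f E'" "f (insert x E) \<le> f (insert x E')" if "E \<subseteq> E'" "E' \<subseteq> X" for E E'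
    using that by (auto intro!: insert.prems(2))
  have 1: "bern r X f \<le> bern s X f"
    by (rule insert.IH) (use insert.prems(1) mono in auto)
  have 2: "bern r X (\<lambda>E. f (insert x E)) \<le> bern s X (\<lambda>E. f (insert x E))"
    by (rule insert.IH) (use insert.prems(1) mono in auto)
  have 3: "bern s X f \<le> bern s X (\<lambda>E. f (insert x E))"
    by (rule bern_mono) (use insert.prems in \<open>auto intro: order_trans intro!: insert.prems(2)\<close>)
  have "r x * bern r X (\<lambda>E. f (insert x E)) + (1 - r x) * bern r X f
      \<le> r x * bern s X (\<lambda>E. f (insert x E)) + (1 - r x) * bern s X f"
    using 1 2 insert.prems(1)[of x] by (intro add_mono mult_left_mono) auto
  also have "\<dots> \<le> s x * bern s X (\<lambda>E. f (insert x E)) + (1 - s x) * bern s X f"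
  proof -
    have "0 \<le> (s x - r x) * (bern s X (\<lambda>E. f (insert x E)) - bern s X f)"
      using 3 insert.prems(1)[of x] by simp
    then show ?thesis by (simp add: algebra_simps)
  qed
  finally show ?case
    using insert.hyps by (simp add: bern_insert)
qed simp

text \<open>Sequential exposure: the elements of \<open>X\<close> are revealed one at a time, and each revealed
  coordinate of \<open>G\<close> is traded for an independent one. In the trade of \<open>e\<close>, \<open>P\<close> is the part already
  revealed and \<open>F\<close> its outcome.\<close>
lemma bern_sequential_comparison:
  fixes f :: "'b set \<Rightarrow> real" and G :: "'a set \<Rightarrow> 'b set"
  assumes "finite T" "finite X" and G: "\<And>J. J \<subseteq> T \<Longrightarrow> G J \<subseteq> X"
    and b: "\<And>x. x \<in> T \<Longrightarrow> 0 \<le> b x \<and> b x \<le> 1"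
    and r: "\<And>x. x \<in> X \<Longrightarrow> 0 \<le> r x \<and> r x \<le> 1"
    and step: "\<And>P e F H. P \<subseteq> X \<Longrightarrow> e \<in> X \<Longrightarrow> e \<notin> P \<Longrightarrow> F \<subseteq> P \<Longrightarrow> H \<subseteq> X \<Longrightarrow> e \<notin> H \<Longrightarrow> H \<inter> P = F \<Longrightarrow>
        0 \<le> (r e * bern b T (\<lambda>J. of_bool (G J \<inter> P = F))
              - bern b T (\<lambda>J. of_bool (G J \<inter> P = F \<and> e \<in> G J))) * (f (insert e H) - f H)"
  shows "bern b T (\<lambda>J. f (G J)) \<le> bern r X f"
proof -
  \<comment> \<open>Hybrid expectation: coordinates in \<open>P\<close> come from
    \<open>G J\<close>, the others are independent. \<open>\<Phi> {}\<close> is the product side,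
    \<open>\<Phi> X\<close> the side of \<open>G\<close>, and no trade may increase the
    value.\<close>
  define \<Phi> where "\<Phi> P = bern b T (\<lambda>J. bern r (X - P) (\<lambda>E. f ((G J \<inter> P) \<union> E)))" for P
  have "\<Phi> P \<le> bern r X f" if "finite P" "P \<subseteq> X" for P
    using that
  proof (induction P rule: finite_induct)
    case empty
    then show ?case using assms by (simp add: \<Phi>_def)
  next
    case (insert e P)
    define Y where "Y = X - insert e P"
    have XP: "X - P = insert e Y" "e \<notin> Y" "finite Y" "Y \<subseteq> X" "Y \<inter> P = {}"
      using insert assms(2) by (auto simp: Y_def)
    \<comment> \<open>Expected increment of \<open>f\<close> at \<open>e\<close>. It depends on
      \<open>J\<close> only through the history, so the difference of consecutive hybrids splits
      into one term for each history \<open>F\<close>.\<close>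
    define K where "K F = bern r Y (\<lambda>E. f (insert e (F \<union> E)) - f (F \<union> E))" for F
    have "\<Phi> P - \<Phi> (insert e P) = bern b T (\<lambda>J. K (G J \<inter> P) * (r e - of_bool (e \<in> G J)))"
      unfolding \<Phi>_def bern_diff[symmetric]
    proof (rule bern_cong)
      fix J assume "J \<subseteq> T"
      show "bern r (X - P) (\<lambda>E. f (G J \<inter> P \<union> E)) - bern r (X - insert e P) (\<lambda>E. f (G J \<inter> insert e P \<union> E))
          = K (G J \<inter> P) * (r e - of_bool (e \<in> G J))"
        unfolding Y_def[symmetric] XP(1) K_def using XP(2,3)
        by (auto simp: bern_insert bern_diff algebra_simps)
    qed
    also have "\<dots> = bern b T (\<lambda>J. \<Sum>F\<in>Pow P. K F * (r e * of_bool (G J \<inter> P = F) - of_bool (G J \<inter> P = F \<and> e \<in> G J)))"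
    proof (rule bern_cong)
      fix J assume "J \<subseteq> T"
      have "(\<Sum>F\<in>Pow P. K F * (r e * of_bool (G J \<inter> P = F) - of_bool (G J \<inter> P = F \<and> e \<in> G J)))
          = (\<Sum>F\<in>Pow P. if F = G J \<inter> P then K (G J \<inter> P) * (r e - of_bool (e \<in> G J)) else 0)"
        by (rule sum.cong) auto
      also have "\<dots> = K (G J \<inter> P) * (r e - of_bool (e \<in> G J))"
        using insert.hyps by (simp add: sum.delta)
      finally show "K (G J \<inter> P) * (r e - of_bool (e \<in> G J)) = (\<Sum>F\<in>Pow P. K F * (r e * of_bool (G J \<inter> P = F) - of_bool (G J \<inter> P = F \<and> e \<in> G J)))" ..
    qed
    also have "\<dots> = (\<Sum>F\<in>Pow P. K F * (r e * bern b T (\<lambda>J. of_bool (G J \<inter> P = F))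
              - bern b T (\<lambda>J. of_bool (G J \<inter> P = F \<and> e \<in> G J))))"
      by (simp add: bern_sum bern_cmult bern_diff)
    also have "\<dots> \<ge> 0"
    proof (rule sum_nonneg)
      fix F assume F: "F \<in> Pow P"
      define c where "c = r e * bern b T (\<lambda>J. of_bool (G J \<inter> P = F))
              - bern b T (\<lambda>J. of_bool (G J \<inter> P = F \<and> e \<in> G J))"
      have "0 \<le> bern r Y (\<lambda>E. c * (f (insert e (F \<union> E)) - f (F \<union> E)))"
      proof (rule bern_nonneg)
        fix E assume "E \<subseteq> Y"
        then show "0 \<le> c * (f (insert e (F \<union> E)) - f (F \<union> E))"
          unfolding c_def using insert F XP by (intro step) auto
      qed (use XP r in auto)
      then show "0 \<le> K F * (r e * bern b T (\<lambda>J. of_bool (G J \<inter> P = F))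
              - bern b T (\<lambda>J. of_bool (G J \<inter> P = F \<and> e \<in> G J)))"
        unfolding c_def[symmetric] by (simp add: bern_cmult K_def mult.commute)
    qed
    finally have "\<Phi> (insert e P) \<le> \<Phi> P" by simp
    then show ?case using insert by auto
  qed
  from this[OF assms(2)] have "\<Phi> X \<le> bern r X f" by simp
  moreover have "\<Phi> X = bern b T (\<lambda>J. f (G J))"
    unfolding \<Phi>_def by (rule bern_cong) (use G in \<open>auto simp: Int_absorb2\<close>)
  ultimately show ?thesis by simp
qed

text \<open>The law that picks at most one \<open>x\<close>, with probability proportional to \<open>w x\<close> (and to \<open>c\<close> for
  picking none), lies below a product law.\<close>
lemma single_choice_le_bern:
  assumes "finite X" "0 < c" and w: "\<And>x. x \<in> X \<Longrightarrow> 0 \<le> w x"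
    and r: "\<And>x. x \<in> X \<Longrightarrow> w x \<le> r x * c \<and> r x \<le> 1"
    and mono: "\<And>E E'. E \<subseteq> E' \<Longrightarrow> E' \<subseteq> X \<Longrightarrow> H E \<le> H E'"
  shows "(\<Sum>x\<in>X. w x * H {x}) + c * H {} \<le> ((\<Sum>x\<in>X. w x) + c) * bern r X H"
  using assms(1) w r mono
proof (induction X rule: finite_induct)
  case (insert x X)
  have r0: "0 \<le> r y" if "y \<in> insert x X" for y
  proof -
    have "0 \<le> r y * c" using insert.prems(1,2)[OF that] by linarith
    then show ?thesis using \<open>0 < c\<close> by (simp add: zero_le_mult_iff)
  qed
  define s where "s = (\<Sum>x\<in>X. w x) + c"
  define B where "B = bern r X H"
  define B1 where "B1 = bern r X (\<lambda>E. H (insert x E))"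
  have mono: "H E \<le> H E'" if "E \<subseteq> E'" "E' \<subseteq> X" for E E'
    using that by (auto intro!: insert.prems(3))
  have IH: "(\<Sum>x\<in>X. w x * H {x}) + c * H {} \<le> s * B"
    unfolding s_def B_def by (rule insert.IH) (use insert.prems(1,2) mono in auto)
  have BB1: "B \<le> B1" unfolding B_def B1_def
    by (rule bern_mono) (use insert.prems(2) r0 in \<open>auto intro!: insert.prems(3)\<close>)
  have "bern r X (\<lambda>_. H {x}) \<le> B1" unfolding B1_def
    by (rule bern_mono) (use insert.prems(2) r0 in \<open>auto intro!: insert.prems(3)\<close>)
  then have HB1: "H {x} \<le> B1" using insert.hyps by simp
  have s: "c \<le> s" unfolding s_def using insert.prems by (auto intro!: sum_nonneg)
  \<comment> \<open>Peeling off \<open>x\<close> leaves weight \<open>s\<close> for the other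
    outcomes, so \<open>x\<close> is picked with relative weight \<open>w x / (s + w x)\<close>.
    This is at most \<open>r x\<close>, because \<open>w x / c\<close> already is and
    \<open>c \<le> s\<close>.\<close>
  have "w x \<le> r x * c" using insert.prems by auto
  also have "\<dots> \<le> r x * (s + w x)"
    using s r0[of x] insert.prems(1)[of x] by (intro mult_left_mono) auto
  finally have "0 \<le> ((s + w x) * r x - w x) * (B1 - B)"
    using BB1 by (simp add: mult_ac)
  moreover have "w x * H {x} \<le> w x * B1"
    using HB1 insert.prems(1)[of x] by (intro mult_left_mono) auto
  ultimately have "w x * H {x} + s * B \<le> (s + w x) * (r x * B1 + (1 - r x) * B)"
    by (simp add: algebra_simps)
  then show ?case
    using insert.hyps IH by (simp add: bern_insert s_def B_def B1_def algebra_simps)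
qed simp

definition clique :: "nat set \<Rightarrow> nat set set" where
  "clique V = {e \<in> Pow V. card e = 2}"

lemma clique_mono: "V \<subseteq> W \<Longrightarrow> clique V \<subseteq> clique W"
  by (auto simp: clique_def)

lemma all_edges_eq_clique: "all_edges n = clique {0..<n}"
proof (intro set_eqI)
  fix e
  show "e \<in> all_edges n \<longleftrightarrow> e \<in> clique {0..<n}"
    unfolding all_edges_def clique_def mem_Collect_eq card_2_iff by auto metis
qed

lemma finite_all_edges [simp]: "finite (all_edges n)"
  by (simp add: all_edges_eq_clique clique_def)

lemma card_all_edges: "card (all_edges n) = n choose 2"
proof -
  have "all_edges n = {e. e \<subseteq> {0..<n} \<and> card e = 2}"
    by (auto simp: all_edges_eq_clique clique_def)
  then show ?thesis using n_subsets[of "{0..<n}" 2] by simp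
qed

lemma gnp_prob_eq_bern:
  "gnp_prob n q P = bern (\<lambda>_. max 0 (min 1 q)) (all_edges n) (\<lambda>E. of_bool (E \<in> P))"
  unfolding gnp_prob_def bern_def Let_def
  by (intro sum.cong refl) (auto simp: card_Diff_subset finite_subset[OF _ finite_all_edges])

subsection \<open>Graphs generated by objects\<close>

text \<open>The parameter \<open>c\<close> says which edges an object contributes, given the set of
  vertices that choose it. \<open>clique\<close> gives the intersection graph,
  \<open>pair_edge\<close> the subgraph used for the lower bound.\<close>

definition object_graph :: "(nat set \<Rightarrow> nat set set) \<Rightarrow> nat \<Rightarrow> nat \<Rightarrow> (nat \<times> nat) set \<Rightarrow> nat set set" where
  "object_graph c n m S = (\<Union>w<m. c {v. v < n \<and> (v, w) \<in> S})"

lemma intersection_graph_eq: "intersection_graph n m S = object_graph clique n m S"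
  by (auto simp: intersection_graph_def object_graph_def clique_def card_2_iff)

lemma rig_prob_eq_bern:
  "rig_prob n m p P
   = bern (\<lambda>_. p) ({0..<n} \<times> {0..<m}) (\<lambda>S. of_bool (object_graph clique n m S \<in> P))"
  unfolding rig_prob_def bern_def intersection_graph_eq
  by (intro sum.cong refl) (auto simp: card_Diff_subset finite_subset)

text \<open>The choices concerning object \<open>m\<close> form a block of coordinates disjoint from
  all others, hence independent of them. This is the recursion for inductions on the number of
  objects.\<close>

lemma bern_object_graph_Suc:
  "bern (\<lambda>_. p) ({0..<n} \<times> {0..<Suc m}) (\<lambda>S. f (object_graph c n (Suc m) S))
   = bern (\<lambda>_. p) {0..<n} (\<lambda>V. bern (\<lambda>_. p) ({0..<n} \<times> {0..<m}) (\<lambda>S. f (c V \<union> object_graph c n m S)))"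
proof -
  have eq: "{0..<n} \<times> {0..<Suc m} = (\<lambda>v. (v, m)) ` {0..<n} \<union> {0..<n} \<times> {0..<m}"
    by auto
  have inj: "inj_on (\<lambda>v. (v, m)) {0..<n}"
    by (auto simp: inj_on_def)
  show ?thesis
    unfolding eq
  proof (subst bern_Un)
    show "bern (\<lambda>_. p) ((\<lambda>v. (v, m)) ` {0..<n})
       (\<lambda>E. bern (\<lambda>_. p) ({0..<n} \<times> {0..<m}) (\<lambda>E'. f (object_graph c n (Suc m) (E \<union> E'))))
      = bern (\<lambda>_. p) {0..<n} (\<lambda>V. bern (\<lambda>_. p) ({0..<n} \<times> {0..<m}) (\<lambda>S. f (c V \<union> object_graph c n m S)))"
      unfolding bern_image[OF finite_atLeastLessThan inj]
    proof (intro bern_cong)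
      fix V S assume VS: "V \<subseteq> {0..<n}" "S \<subseteq> {0..<n} \<times> {0..<m}"
      have 1: "{v. v < n \<and> (v, m) \<in> (\<lambda>v. (v, m)) ` V \<union> S} = V"
        using VS by auto
      have 2: "{v. v < n \<and> (v, w) \<in> (\<lambda>v. (v, m)) ` V \<union> S} = {v. v < n \<and> (v, w) \<in> S}" if "w < m" for w
        using VS that by auto
      have "object_graph c n (Suc m) ((\<lambda>v. (v, m)) ` V \<union> S) = c V \<union> object_graph c n m S"
        unfolding object_graph_def lessThan_Suc UN_insert 1 using 2 by auto
      then show "f (object_graph c n (Suc m) ((\<lambda>v. (v, m)) ` V \<union> S)) = f (c V \<union> object_graph c n m S)"
        by simp
    qed
  qed auto
qed

lemma object_graph_subset:
  assumes "\<And>V. V \<subseteq> {0..<n} \<Longrightarrow> c V \<subseteq> X"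
  shows "object_graph c n m S \<subseteq> X"
  unfolding object_graph_def by (intro UN_least assms) auto

subsection \<open>The lower bound\<close>

definition pair_edge :: "nat set \<Rightarrow> nat set set" where
  "pair_edge V = (if card V = 2 then {V} else {})"

lemma pair_edge_subset_clique: "finite V \<Longrightarrow> pair_edge V \<subseteq> clique V"
  by (auto simp: pair_edge_def clique_def)

text \<open>An object contributes the edge \<open>e\<close> exactly if its set of choosers is
  \<open>e\<close>, so all edges carry the same weight \<open>p2\<close> and the remaining mass
  contributes nothing. Subtracting \<open>\<phi> {}\<close> in the proof removes all other sets from
  the sum.\<close>

lemma bern_pair_edge:
  fixes p p2 :: real and n :: nat
  defines "p2 \<equiv> p ^ 2 * (1 - p) ^ (n - 2)"
  shows "bern (\<lambda>_. p) {0..<n} (\<lambda>V. \<phi> (pair_edge V))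
    = p2 * (\<Sum>e\<in>all_edges n. \<phi> {e}) + (1 - card (all_edges n) * p2) * \<phi> {}"
proof -
  have sub: "all_edges n \<subseteq> Pow {0..<n}"
    by (auto simp: all_edges_eq_clique clique_def)
  have "bern (\<lambda>_. p) {0..<n} (\<lambda>V. \<phi> (pair_edge V)) - \<phi> {}
      = bern (\<lambda>_. p) {0..<n} (\<lambda>V. \<phi> (pair_edge V) - \<phi> {})"
    by (simp add: bern_diff)
  also have "\<dots> = (\<Sum>e\<in>all_edges n. (\<Prod>x\<in>e. p) * (\<Prod>x\<in>{0..<n} - e. 1 - p) * (\<phi> (pair_edge e) - \<phi> {}))"
    unfolding bern_def
    by (rule sum.mono_neutral_right) (use sub in \<open>auto simp: pair_edge_def all_edges_eq_clique clique_def\<close>)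
  also have "\<dots> = (\<Sum>e\<in>all_edges n. p2 * (\<phi> {e} - \<phi> {}))"
  proof (intro sum.cong refl)
    fix e assume "e \<in> all_edges n"
    then have "card e = 2" "finite e" "e \<subseteq> {0..<n}"
      by (auto simp: all_edges_eq_clique clique_def intro: finite_subset)
    then show "(\<Prod>x\<in>e. p) * (\<Prod>x\<in>{0..<n} - e. 1 - p) * (\<phi> (pair_edge e) - \<phi> {}) = p2 * (\<phi> {e} - \<phi> {})"
      by (simp add: pair_edge_def p2_def card_Diff_subset)
  qed
  finally show ?thesis
    by (simp add: sum_subtractf sum_distrib_left[symmetric] algebra_simps)
qed

text \<open>The events "the choosers are exactly \<open>e\<close>" are disjoint for different edges,
  and their union has probability at most 1.\<close>

lemma card_all_edges_mult_le_1:
  fixes p :: real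
  assumes "0 \<le> p" "p \<le> 1"
  shows "card (all_edges n) * (p ^ 2 * (1 - p) ^ (n - 2)) \<le> 1"
proof -
  have "bern (\<lambda>_. p) {0..<n} (\<lambda>V. of_bool (pair_edge V \<noteq> {})) \<le> (1::real)"
    using assms by (intro bern_le_1) auto
  then show ?thesis
    by (subst (asm) bern_pair_edge) (simp add: mult.commute)
qed

text \<open>Each of the edges already found accounts for one object, and the other objects still find
  \<open>e\<close> with at least the unconditional probability.\<close>
lemma pair_graph_avoid:
  fixes p p2 :: real and n :: nat and h :: "nat \<Rightarrow> nat set set \<Rightarrow> nat set set \<Rightarrow> real"
  defines "p2 \<equiv> p ^ 2 * (1 - p) ^ (n - 2)"
  defines "h \<equiv> \<lambda>M F U. bern (\<lambda>_. p) ({0..<n} \<times> {0..<M})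
      (\<lambda>S. of_bool (F \<subseteq> object_graph pair_edge n M S \<and> object_graph pair_edge n M S \<inter> U = {}))"
  assumes p: "0 \<le> p" "p \<le> 1"
  assumes "F \<subseteq> all_edges n" "U \<subseteq> all_edges n" "F \<inter> U = {}" "e \<in> all_edges n" "e \<notin> F" "e \<notin> U"
  shows "h M F (insert e U) \<le> (1 - p2) ^ (M - card F) * h M F U"
proof -
  define N where "N = card (all_edges n)"
  have N1: "N * p2 \<le> 1"
    using card_all_edges_mult_le_1[OF p, of n] by (simp add: N_def p2_def)
  have p2: "0 \<le> p2" using p by (simp add: p2_def)
  have h0: "0 \<le> h M F U" for M F U
    unfolding h_def by (rule bern_nonneg) (use p in auto)
  have cardle: "card F + card U \<le> N" if "F \<subseteq> all_edges n" "U \<subseteq> all_edges n" "F \<inter> U = {}" for F U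
  proof -
    have "card F + card U = card (F \<union> U)"
      using that by (intro card_Un_disjoint[symmetric]) (auto intro: finite_subset)
    also have "\<dots> \<le> N" unfolding N_def using that by (intro card_mono) auto
    finally show ?thesis .
  qed
  \<comment> \<open>Condition on one object: it supplies some \<open>g \<in> F\<close>, which then
    need not be found again, or an edge of \<open>U\<close>, which is forbidden, or nothing
    relevant.\<close>
  have rec: "h (Suc M) F U = p2 * (\<Sum>g\<in>F. h M (F - {g}) U) + (1 - p2 * (card F + card U)) * h M F U"
    if FU: "F \<subseteq> all_edges n" "U \<subseteq> all_edges n" "F \<inter> U = {}" for M F U
  proof -
    have fin: "finite F" "finite U" using FU by (auto intro: finite_subset)
    define H where "H G = bern (\<lambda>_. p) ({0..<n} \<times> {0..<M})
      (\<lambda>S. of_bool (F \<subseteq> G \<union> object_graph pair_edge n M S \<and> (G \<union> object_graph pair_edge n M S) \<inter> U = {}) :: real)" for G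
    have "h (Suc M) F U = bern (\<lambda>_. p) {0..<n} (\<lambda>V. H (pair_edge V))"
      unfolding h_def H_def
      by (rule bern_object_graph_Suc[where f = "\<lambda>G. of_bool (F \<subseteq> G \<and> G \<inter> U = {})"])
    also have "\<dots> = p2 * (\<Sum>g\<in>all_edges n. H {g}) + (1 - N * p2) * H {}"
      unfolding p2_def N_def by (rule bern_pair_edge)
    also have "H {} = h M F U" by (simp add: H_def h_def)
    also have "(\<Sum>g\<in>all_edges n. H {g}) = (\<Sum>g\<in>F. h M (F - {g}) U) + (N - card F - card U) * h M F U"
    proof -
      have U: "H {g} = 0" if "g \<in> U" for g
      proof -
        have "H {g} = bern (\<lambda>_. p) ({0..<n} \<times> {0..<M}) (\<lambda>_. 0)"
          unfolding H_def by (rule bern_cong) (use that in auto)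
        then show ?thesis by simp
      qed
      have Fg: "H {g} = h M (F - {g}) U" if "g \<in> F" for g
        unfolding H_def h_def
        by (rule bern_cong, rule arg_cong[of _ _ of_bool]) (use that FU in auto)
      have R: "H {g} = h M F U" if "g \<in> all_edges n - F - U" for g
        unfolding H_def h_def
        by (rule bern_cong, rule arg_cong[of _ _ of_bool]) (use that FU in auto)
      have "(\<Sum>g\<in>all_edges n. H {g}) = (\<Sum>g\<in>F. H {g}) + (\<Sum>g\<in>all_edges n - F. H {g})"
        using FU by (subst add.commute, subst sum.subset_diff[symmetric]) auto
      also have "(\<Sum>g\<in>all_edges n - F. H {g}) = (\<Sum>g\<in>all_edges n - F - U. H {g}) + (\<Sum>g\<in>U. H {g})"
        using FU by (subst sum.subset_diff[symmetric]) auto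
      also have "(\<Sum>g\<in>all_edges n - F - U. H {g}) = real (card (all_edges n - F - U)) * h M F U"
        using R by simp
      also have "card (all_edges n - F - U) = N - card F - card U"
        unfolding N_def using FU fin by (subst card_Diff_subset; auto simp: card_Diff_subset)
      finally show ?thesis using U Fg cardle[OF FU] by simp
    qed
    finally show ?thesis using cardle[OF FU] by (simp add: algebra_simps)
  qed
  show ?thesis
    using assms(5-)
  proof (induction M arbitrary: F)
    case 0
    have "h 0 F (insert e U) \<le> h 0 F U" unfolding h_def
      by (rule bern_mono) (use p in auto)
    then show ?case by simp
  next
    case (Suc M)
    define a where "a = 1 - p2"
    define C where "C = 1 - p2 * (card F + card U)"
    have fin: "finite F" "finite U" using Suc.prems by (auto intro: finite_subset)
    have eU: "card F + Suc (card U) \<le> N"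
      using cardle[of F "insert e U"] Suc.prems fin by auto
    have "p2 * (card F + Suc (card U)) \<le> p2 * N"
      using eU p2 by (intro mult_left_mono) (auto simp flip: of_nat_Suc of_nat_add)
    then have C: "0 \<le> C - p2" using N1 unfolding C_def by (simp add: algebra_simps)
    have "0 \<le> p2 * (card F + card U)" using p2 by simp
    then have a: "0 \<le> a" "a \<le> 1" using C p2 unfolding a_def C_def by linarith+
    \<comment> \<open>Forbidding \<open>e\<close> as well takes \<open>p2\<close> from the
      coefficient \<open>C\<close> of the irrelevant outcomes; since \<open>C \<le> 1\<close>, this
      is at least as strong as a factor \<open>1 - p2\<close>.\<close>
    have Ca: "C - p2 \<le> C * a"
      using p2 mult_nonneg_nonneg[OF p2 p2] unfolding C_def a_def by (simp add: algebra_simps)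
    have "h (Suc M) F (insert e U) = p2 * (\<Sum>g\<in>F. h M (F - {g}) (insert e U)) + (C - p2) * h M F (insert e U)"
      using Suc.prems fin by (subst rec) (auto simp: C_def algebra_simps)
    also have "\<dots> \<le> p2 * (\<Sum>g\<in>F. a ^ (Suc M - card F) * h M (F - {g}) U) + a ^ (Suc M - card F) * C * h M F U"
    proof (intro add_mono mult_left_mono p2 sum_mono)
      fix g assume g: "g \<in> F"
      have "h M (F - {g}) (insert e U) \<le> (1 - p2) ^ (M - card (F - {g})) * h M (F - {g}) U"
        by (rule Suc.IH) (use Suc.prems in auto)
      \<comment> \<open>The edge \<open>g\<close> and the object that supplied it drop out together,
        so the exponent does not change.\<close>
      moreover have "M - card (F - {g}) = Suc M - card F"
        using card.remove[OF fin(1) g] by simp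
      ultimately show "h M (F - {g}) (insert e U) \<le> a ^ (Suc M - card F) * h M (F - {g}) U"
        by (simp add: a_def)
    next
      have "h M F (insert e U) \<le> a ^ (M - card F) * h M F U"
        unfolding a_def by (rule Suc.IH) (use Suc.prems in auto)
      then have "(C - p2) * h M F (insert e U) \<le> (C * a) * (a ^ (M - card F) * h M F U)"
        using C Ca a h0 by (intro mult_mono) auto
      also have "\<dots> = C * h M F U * a ^ Suc (M - card F)" by simp
      \<comment> \<open>Truncated subtraction: the exponents agree for
        \<open>card F \<le> M\<close>; otherwise the left one is 1 and the right one 0.\<close>
      also have "\<dots> \<le> C * h M F U * a ^ (Suc M - card F)"
        using a C p2 h0 by (intro mult_left_mono power_decreasing) auto
      finally show "(C - p2) * h M F (insert e U) \<le> a ^ (Suc M - card F) * C * h M F U"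
        by (simp add: mult_ac)
    qed
    also have "\<dots> = a ^ (Suc M - card F) * (p2 * (\<Sum>g\<in>F. h M (F - {g}) U) + C * h M F U)"
      by (simp add: sum_distrib_left algebra_simps)
    also have "p2 * (\<Sum>g\<in>F. h M (F - {g}) U) + C * h M F U = h (Suc M) F U"
      using Suc.prems by (subst rec) (auto simp: C_def)
    finally show ?case by (simp add: a_def)
  qed
qed

text \<open>No history contains more than \<open>card (all_edges n)\<close> edges, so discarding
  that many objects gives a one-step bound independent of the history.\<close>

lemma gnp_le_rig:
  fixes p :: real
  assumes p: "0 \<le> p" "p \<le> 1"
    and mono: "\<And>G G'. G \<in> P \<Longrightarrow> G \<subseteq> G' \<Longrightarrow> G' \<subseteq> all_edges n \<Longrightarrow> G' \<in> P"
  shows "gnp_prob n (1 - (1 - p ^ 2 * (1 - p) ^ (n - 2)) ^ (m - card (all_edges n))) P \<le> rig_prob n m p P"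
proof (cases "all_edges n = {}")
  case True
  then have "object_graph clique n m S = {}" for S
    using object_graph_subset[of n clique "all_edges n" m S] clique_mono[of _ "{0..<n}"]
    by (simp add: all_edges_eq_clique)
  then show ?thesis using True
    by (simp add: gnp_prob_eq_bern rig_prob_eq_bern)
next
  case False
  let ?X = "all_edges n" and ?T = "{0..<n} \<times> {0..<m}" and ?G = "object_graph pair_edge n m"
  define p2 where "p2 = p ^ 2 * (1 - p) ^ (n - 2)"
  define s where "s = 1 - (1 - p2) ^ (m - card ?X)"
  have "1 * p2 \<le> card ?X * p2"
    using False p by (intro mult_right_mono) (auto simp: p2_def Suc_le_eq card_gt_0_iff)
  then have p2: "0 \<le> p2" "p2 \<le> 1"
    using card_all_edges_mult_le_1[OF p, of n] p by (auto simp: p2_def)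
  have s: "0 \<le> s" "s \<le> 1" using p2 by (auto simp: s_def power_le_one)
  have sub: "?G S \<subseteq> ?X" for S
    by (rule object_graph_subset)
       (auto simp: pair_edge_def all_edges_eq_clique clique_def)
  \<comment> \<open>The comparison bounds the expectation over the objects from above; the sign
    turns this into the lower bound wanted here.\<close>
  have "bern (\<lambda>_. p) ?T (\<lambda>S. - of_bool (?G S \<in> P)) \<le> bern (\<lambda>_. s) ?X (\<lambda>E. - of_bool (E \<in> P))"
  proof (rule bern_sequential_comparison)
    fix E e F H
    assume A: "E \<subseteq> ?X" "e \<in> ?X" "e \<notin> E" "F \<subseteq> E" "H \<subseteq> ?X" "e \<notin> H" "H \<inter> E = F"
    let ?U = "E - F"
    define h where "h U = bern (\<lambda>_. p) ?T (\<lambda>S. of_bool (F \<subseteq> ?G S \<and> ?G S \<inter> U = {}) :: real)" for U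
    have 1: "bern (\<lambda>_. p) ?T (\<lambda>S. of_bool (?G S \<inter> E = F)) = h ?U"
      unfolding h_def by (rule bern_cong, rule arg_cong[of _ _ of_bool]) (use A in auto)
    have "bern (\<lambda>_. p) ?T (\<lambda>S. of_bool (?G S \<inter> E = F \<and> e \<in> ?G S)) = h ?U - h (insert e ?U)"
      unfolding h_def bern_diff[symmetric]
      by (rule bern_cong) (use A in auto)
    moreover have "h (insert e ?U) \<le> (1 - p2) ^ (m - card F) * h ?U"
      unfolding h_def p2_def by (rule pair_graph_avoid[OF p]) (use A in auto)
    moreover have "(1 - p2) ^ (m - card F) * h ?U \<le> (1 - p2) ^ (m - card ?X) * h ?U"
      using p2 A p card_mono[of ?X F] unfolding h_def
      by (intro mult_right_mono power_decreasing bern_nonneg diff_le_mono2) auto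
    ultimately have "s * h ?U \<le> bern (\<lambda>_. p) ?T (\<lambda>S. of_bool (?G S \<inter> E = F \<and> e \<in> ?G S))"
      by (simp add: s_def algebra_simps)
    then show "0 \<le> (s * bern (\<lambda>_. p) ?T (\<lambda>S. of_bool (?G S \<inter> E = F)) -
            bern (\<lambda>_. p) ?T (\<lambda>S. of_bool (?G S \<inter> E = F \<and> e \<in> ?G S))) *
           (- of_bool (insert e H \<in> P) - - of_bool (H \<in> P))"
      unfolding 1 using mono[of H "insert e H"] A
      by (intro mult_nonpos_nonpos) auto
  qed (use p s sub in auto)
  then have "bern (\<lambda>_. s) ?X (\<lambda>E. of_bool (E \<in> P)) \<le> bern (\<lambda>_. p) ?T (\<lambda>S. of_bool (?G S \<in> P))"
    by (simp add: bern_uminus)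
  also have "\<dots> \<le> rig_prob n m p P"
    unfolding rig_prob_eq_bern
  proof (rule bern_mono)
    fix S
    have "?G S \<subseteq> object_graph clique n m S"
      unfolding object_graph_def by (intro UN_mono pair_edge_subset_clique) auto
    moreover have "object_graph clique n m S \<subseteq> ?X"
      by (rule object_graph_subset) (simp add: all_edges_eq_clique clique_mono)
    ultimately show "of_bool (?G S \<in> P) \<le> (of_bool (object_graph clique n m S \<in> P) :: real)"
      using mono by auto
  qed (use p in auto)
  finally show ?thesis
    using s by (simp add: gnp_prob_eq_bern s_def p2_def)
qed

subsection \<open>The upper bound\<close>

definition types :: "nat \<Rightarrow> nat \<Rightarrow> nat set set" where
  "types K n = {S \<in> Pow {0..<n}. 2 \<le> card S \<and> card S \<le> K}"

definition type_graph :: "nat set set \<Rightarrow> nat set set" where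
  "type_graph J = (\<Union>S\<in>J. clique S)"

lemma finite_types [simp]: "finite (types K n)"
  by (simp add: types_def)

lemma clique_subset_all_edges: "S \<subseteq> {0..<n} \<Longrightarrow> clique S \<subseteq> all_edges n"
  by (simp add: all_edges_eq_clique clique_mono)

lemma type_graph_subset: "J \<subseteq> types K n \<Longrightarrow> type_graph J \<subseteq> all_edges n"
  unfolding type_graph_def by (intro UN_least clique_subset_all_edges) (auto simp: types_def)

lemma type_graph_Un: "type_graph (J \<union> J') = type_graph J \<union> type_graph J'"
  by (auto simp: type_graph_def)

lemma type_graph_mono: "J \<subseteq> J' \<Longrightarrow> type_graph J \<subseteq> type_graph J'"
  by (auto simp: type_graph_def)

lemma clique_edge: "card e = 2 \<Longrightarrow> clique e = {e}"
  unfolding clique_def using card_subset_eq[of e] card_ge_0_finite[of e] by auto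

lemma clique_small:
  assumes "finite V" "card V \<le> 1" shows "clique V = {}"
proof -
  have "card e \<noteq> 2" if "e \<subseteq> V" for e
    using card_mono[OF assms(1) that] assms(2) by linarith
  then show ?thesis by (auto simp: clique_def)
qed

text \<open>Union bound over the \<open>k\<close>-subsets that may lie inside \<open>V\<close>, with
  the binomial coefficient estimated by \<open>n ^ k\<close>.\<close>

lemma prob_card_ge:
  assumes "0 \<le> p" "p \<le> 1"
  shows "bern (\<lambda>_. p) {0..<n} (\<lambda>V. of_bool (k \<le> card V)) \<le> (real n * p) ^ k"
proof -
  let ?W = "{W. W \<subseteq> {0..<n} \<and> card W = k}"
  have fin: "finite ?W" by simp
  have "bern (\<lambda>_. p) {0..<n} (\<lambda>V. of_bool (k \<le> card V)) \<le> bern (\<lambda>_. p) {0..<n} (\<lambda>V. \<Sum>W\<in>?W. of_bool (W \<subseteq> V) * 1)"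
  proof (rule bern_mono)
    fix V assume V: "V \<subseteq> {0..<n}"
    show "of_bool (k \<le> card V) \<le> (\<Sum>W\<in>?W. of_bool (W \<subseteq> V) * 1 :: real)"
    proof (cases "k \<le> card V")
      case True
      then obtain W where "W \<subseteq> V" "card W = k" by (meson obtain_subset_with_card_n)
      then have "of_bool (W \<subseteq> V) * 1 \<le> (\<Sum>W\<in>?W. of_bool (W \<subseteq> V) * 1 :: real)"
        using V by (intro member_le_sum) auto
      then show ?thesis using \<open>W \<subseteq> V\<close> by simp
    qed (simp add: sum_nonneg)
  qed (use assms in auto)
  also have "\<dots> = (\<Sum>W\<in>?W. p ^ k)"
    unfolding bern_sum by (intro sum.cong refl, subst bern_superset) auto
  also have "\<dots> = real (n choose k) * p ^ k"
    using n_subsets[of "{0..<n}" k] by simp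
  also have "\<dots> \<le> real (n ^ k) * p ^ k"
  proof (intro mult_right_mono)
    show "real (n choose k) \<le> real (n ^ k)"
      by (cases "k \<le> n") (auto intro: binomial_le_pow simp: binomial_eq_0 simp del: of_nat_power)
  qed (use assms in auto)
  finally show ?thesis by (simp add: power_mult_distrib)
qed

text \<open>The choosers of an object are more than \<open>K\<close>, or at most one and give no
  edge, or form exactly one type. The first event is charged in full; the other two form a
  single-choice law, to which \<open>single_choice_le_bern\<close> applies with the no-edge
  probability as the weight of picking none. The number \<open>c\<close> is any positive lower bound
  for that weight.\<close>

lemma single_object_le_types:
  fixes p :: real and n :: nat and r :: "nat \<Rightarrow> real"
  assumes p: "0 \<le> p" "p \<le> 1" and c: "0 < c" "c \<le> bern (\<lambda>_. p) {0..<n} (\<lambda>V. of_bool (card V \<le> 1))"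
    and r: "\<And>k. 2 \<le> k \<Longrightarrow> k \<le> K \<Longrightarrow> p ^ k * (1 - p) ^ (n - k) \<le> r k * c \<and> r k \<le> 1"
    and mono: "\<And>G G'. G \<subseteq> G' \<Longrightarrow> G' \<subseteq> all_edges n \<Longrightarrow> \<phi> G \<le> \<phi> G'"
    and \<phi>: "\<And>G. G \<subseteq> all_edges n \<Longrightarrow> 0 \<le> \<phi> G \<and> \<phi> G \<le> 1"
  shows "bern (\<lambda>_. p) {0..<n} (\<lambda>V. \<phi> (clique V))
    \<le> (real n * p) ^ Suc K + bern (\<lambda>S. r (card S)) (types K n) (\<lambda>J. \<phi> (type_graph J))"
proof -
  let ?T = "types K n"
  define c' where "c' = bern (\<lambda>_. p) {0..<n} (\<lambda>V. of_bool (card V \<le> 1))"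
  define w where "w S = (\<Prod>x\<in>S. p) * (\<Prod>x\<in>{0..<n} - S. 1 - p)" for S :: "nat set"
  have cc': "c \<le> c'" using c by (simp add: c'_def)
  have w: "w S = p ^ card S * (1 - p) ^ (n - card S)" if "S \<in> ?T" for S
    using that card_Diff_subset[of S "{0..<n}"] finite_subset[of S "{0..<n}"]
    by (simp add: w_def types_def)
  have w0: "0 \<le> w S" for S using p by (auto simp: w_def)
  have bT: "bern (\<lambda>_. p) {0..<n} (\<lambda>V. of_bool (V \<in> ?T) * g V) = (\<Sum>S\<in>?T. w S * g S)" for g
  proof -
    have "bern (\<lambda>_. p) {0..<n} (\<lambda>V. of_bool (V \<in> ?T) * g V) = (\<Sum>V\<in>Pow {0..<n}. w V * (of_bool (V \<in> ?T) * g V))"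
      by (simp add: bern_def w_def)
    also have "\<dots> = (\<Sum>V\<in>?T. w V * (of_bool (V \<in> ?T) * g V))"
      by (rule sum.mono_neutral_right) (auto simp: types_def)
    finally show ?thesis by simp
  qed
  define H where "H J = \<phi> (type_graph J)" for J
  have rr: "0 \<le> r (card S) \<and> w S \<le> r (card S) * c' \<and> r (card S) \<le> 1" if "S \<in> ?T" for S
  proof -
    have S: "w S \<le> r (card S) * c" "r (card S) \<le> 1" using r[of "card S"] w[OF that] that by (auto simp: types_def)
    then have "0 \<le> r (card S) * c" using w0[of S] by linarith
    then have "0 \<le> r (card S)" using c by (simp add: zero_le_mult_iff)
    moreover have "r (card S) * c \<le> r (card S) * c'" using \<open>0 \<le> r (card S)\<close> cc' by (rule mult_left_mono[rotated])
    ultimately show ?thesis using S by linarith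
  qed
  have B0: "0 \<le> bern (\<lambda>S. r (card S)) ?T H"
    unfolding H_def using rr \<phi> type_graph_subset by (intro bern_nonneg) auto
  have "bern (\<lambda>_. p) {0..<n} (\<lambda>V. \<phi> (clique V))
      \<le> bern (\<lambda>_. p) {0..<n} (\<lambda>V. of_bool (Suc K \<le> card V) + (of_bool (V \<in> ?T) * \<phi> (clique V) + \<phi> {} * of_bool (card V \<le> 1)))"
  proof (rule bern_mono)
    fix V assume V: "V \<subseteq> {0..<n}"
    then have *: "clique V \<subseteq> all_edges n" "finite V" by (auto simp: clique_subset_all_edges finite_subset)
    consider "card V \<le> 1" | "V \<in> ?T" | "Suc K \<le> card V" "V \<notin> ?T"
      using V unfolding types_def by (cases "card V \<le> 1"; cases "card V \<le> K") auto
    then show "\<phi> (clique V) \<le> of_bool (Suc K \<le> card V) + (of_bool (V \<in> ?T) * \<phi> (clique V) + \<phi> {} * of_bool (card V \<le> 1))"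
    proof cases
      case 1 then show ?thesis using clique_small[of V] * \<phi>[of "{}"] \<phi>[OF *(1)] by auto
    next
      case 2 then show ?thesis using \<phi>[of "{}"] \<phi>[OF *(1)] by auto
    next
      case 3 then show ?thesis using \<phi>[of "{}"] \<phi>[OF *(1)] by auto
    qed
  qed (use p in auto)
  also have "\<dots> = bern (\<lambda>_. p) {0..<n} (\<lambda>V. of_bool (Suc K \<le> card V)) + ((\<Sum>S\<in>?T. w S * H {S}) + c' * H {})"
    unfolding bern_add bern_cmult bT c'_def[symmetric] by (simp add: H_def type_graph_def)
  also have "\<dots> \<le> (real n * p) ^ Suc K + ((\<Sum>S\<in>?T. w S) + c') * bern (\<lambda>S. r (card S)) ?T H"
  proof (intro add_mono prob_card_ge p single_choice_le_bern)
    fix E E' assume "E \<subseteq> E'" "E' \<subseteq> ?T"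
    then show "H E \<le> H E'" unfolding H_def by (intro mono type_graph_mono type_graph_subset)
  qed (use c cc' w0 rr in auto)
  \<comment> \<open>Distinct types and the no-edge case are disjoint outcomes, so their total weight
    is at most 1; \<open>B0\<close> allows rounding it up.\<close>
  also have "\<dots> \<le> (real n * p) ^ Suc K + 1 * bern (\<lambda>S. r (card S)) ?T H"
  proof (intro add_mono mult_right_mono B0 order_refl)
    have "(\<Sum>S\<in>?T. w S) + c' = bern (\<lambda>_. p) {0..<n} (\<lambda>V. of_bool (V \<in> ?T) * 1 + of_bool (card V \<le> 1))"
      unfolding bern_add bT c'_def by simp
    also have "\<dots> \<le> 1"
      by (rule bern_le_1) (use p in \<open>auto simp: types_def\<close>)
    finally show "(\<Sum>S\<in>?T. w S) + c' \<le> 1" .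
  qed
  finally show ?thesis unfolding H_def by simp
qed

text \<open>Each object is replaced by its own independent family of types at the cost of one error
  term. In the union of \<open>m\<close> such families a type is missing iff all \<open>m\<close>
  copies miss it.\<close>

lemma objects_le_types:
  fixes p :: real and n :: nat and r :: "nat \<Rightarrow> real"
  assumes p: "0 \<le> p" "p \<le> 1" and c: "0 < c" "c \<le> bern (\<lambda>_. p) {0..<n} (\<lambda>V. of_bool (card V \<le> 1))"
    and r: "\<And>k. 2 \<le> k \<Longrightarrow> k \<le> K \<Longrightarrow> p ^ k * (1 - p) ^ (n - k) \<le> r k * c \<and> r k \<le> 1"
    and "\<And>G G'. G \<subseteq> G' \<Longrightarrow> G' \<subseteq> all_edges n \<Longrightarrow> f G \<le> f G'"
    and "\<And>G. G \<subseteq> all_edges n \<Longrightarrow> 0 \<le> f G \<and> f G \<le> 1"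
  shows "bern (\<lambda>_. p) ({0..<n} \<times> {0..<m}) (\<lambda>S. f (object_graph clique n m S))
    \<le> m * (real n * p) ^ Suc K + bern (\<lambda>S. 1 - (1 - r (card S)) ^ m) (types K n) (\<lambda>J. f (type_graph J))"
  using assms(6-)
proof (induction m arbitrary: f)
  case 0
  have "bern (\<lambda>S. 0) (types K n) (\<lambda>J. f (type_graph J)) \<ge> bern (\<lambda>S. 0) (types K n) (\<lambda>J. f {})"
    by (rule bern_mono) (use 0 type_graph_subset in auto)
  then show ?case by (simp add: object_graph_def)
next
  case (Suc m)
  let ?T = "types K n" and ?t = "(real n * p) ^ Suc K"
  have r01: "0 \<le> r (card S) \<and> r (card S) \<le> 1" if "S \<in> ?T" for S
  proof -
    have "2 \<le> card S" "card S \<le> K" using that by (auto simp: types_def)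
    moreover have "0 \<le> p ^ card S * (1 - p) ^ (n - card S)" using p by simp
    ultimately have "0 \<le> r (card S) * c" "r (card S) \<le> 1" using r[of "card S"] by auto
    then show ?thesis using c by (simp add: zero_le_mult_iff)
  qed
  define b where "b S = 1 - (1 - r (card S)) ^ m" for S :: "nat set"
  have b01: "0 \<le> b S \<and> b S \<le> 1" if "S \<in> ?T" for S
    using r01[OF that] by (auto simp: b_def power_le_one)
  \<comment> \<open>Averages over the objects already replaced. It is still monotone with values in
    [0,1], so the one-object comparison applies to it.\<close>
  define \<phi> where "\<phi> G = bern b ?T (\<lambda>J. f (G \<union> type_graph J))" for G
  have "bern (\<lambda>_. p) ({0..<n} \<times> {0..<Suc m}) (\<lambda>S. f (object_graph clique n (Suc m) S))
      = bern (\<lambda>_. p) {0..<n} (\<lambda>V. bern (\<lambda>_. p) ({0..<n} \<times> {0..<m}) (\<lambda>S. f (clique V \<union> object_graph clique n m S)))"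
    by (rule bern_object_graph_Suc)
  also have "\<dots> \<le> bern (\<lambda>_. p) {0..<n} (\<lambda>V. m * ?t + \<phi> (clique V))"
  proof (rule bern_mono)
    fix V assume V: "V \<subseteq> {0..<n}"
    show "bern (\<lambda>_. p) ({0..<n} \<times> {0..<m}) (\<lambda>S. f (clique V \<union> object_graph clique n m S)) \<le> m * ?t + \<phi> (clique V)"
      unfolding \<phi>_def b_def
      by (rule Suc.IH) (use Suc.prems clique_subset_all_edges[OF V] in \<open>auto intro!: Suc.prems(1)\<close>)
  qed (use p in auto)
  also have "\<dots> = m * ?t + bern (\<lambda>_. p) {0..<n} (\<lambda>V. \<phi> (clique V))"
    by (simp add: bern_add)
  also have "\<dots> \<le> m * ?t + (?t + bern (\<lambda>S. r (card S)) ?T (\<lambda>J. \<phi> (type_graph J)))"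
  proof (intro add_left_mono single_object_le_types[OF p c r])
    fix G G' assume G: "G \<subseteq> G'" "G' \<subseteq> all_edges n"
    show "\<phi> G \<le> \<phi> G'"
      unfolding \<phi>_def
    proof (rule bern_mono)
      fix J assume "J \<subseteq> ?T"
      then show "f (G \<union> type_graph J) \<le> f (G' \<union> type_graph J)"
        using G type_graph_subset by (intro Suc.prems(1)) auto
    qed (use b01 in auto)
  next
    fix G assume G: "G \<subseteq> all_edges n"
    have *: "0 \<le> f (G \<union> type_graph J) \<and> f (G \<union> type_graph J) \<le> 1" if "J \<subseteq> ?T" for J
      using G type_graph_subset[OF that] by (intro Suc.prems(2)) auto
    show "0 \<le> \<phi> G \<and> \<phi> G \<le> 1"
      unfolding \<phi>_def using b01 * by (auto intro!: bern_nonneg bern_le_1)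
  qed
  also have "bern (\<lambda>S. r (card S)) ?T (\<lambda>J. \<phi> (type_graph J))
      = bern (\<lambda>S. 1 - (1 - r (card S)) ^ Suc m) ?T (\<lambda>J. f (type_graph J))"
    unfolding \<phi>_def type_graph_Un[symmetric]
    by (subst bern_bern_Un) (simp_all add: b_def)
  finally show ?case by (simp add: algebra_simps)
qed

text \<open>If \<open>S\<close> is used, its edges inside \<open>F\<close> could be covered by pairs instead without changing the
  observed history; the ratio of the two costs bounds the posterior probability of \<open>S\<close>.\<close>
lemma type_posterior:
  fixes b :: "nat set \<Rightarrow> real"
  assumes "2 \<le> K" and b: "\<And>S. S \<in> types K n \<Longrightarrow> 0 \<le> b S \<and> b S \<le> 1"
    and q: "0 < q" "\<And>e. e \<in> all_edges n \<Longrightarrow> b e = q"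
    and "F \<subseteq> P" "P \<subseteq> all_edges n" "e \<in> all_edges n" "e \<notin> P"
  defines "hist \<equiv> bern b (types K n) (\<lambda>J. of_bool (type_graph J \<inter> P = F))"
  shows "bern b (types K n) (\<lambda>J. of_bool (type_graph J \<inter> P = F \<and> e \<in> type_graph J))
    \<le> (\<Sum>S | S \<in> types K n \<and> e \<subseteq> S. b S * (1 / q) ^ card (clique S \<inter> F)) * hist"
proof -
  let ?T = "types K n"
  let ?E = "{S \<in> ?T. e \<subseteq> S}"
  have e2: "card e = 2" using assms by (auto simp: all_edges_eq_clique clique_def)
  have hist0: "0 \<le> hist" unfolding hist_def using b by (intro bern_nonneg) auto
  have "bern b ?T (\<lambda>J. of_bool (type_graph J \<inter> P = F \<and> e \<in> type_graph J))
      \<le> bern b ?T (\<lambda>J. \<Sum>S\<in>?E. of_bool (S \<in> J) * of_bool (type_graph J \<inter> P = F))"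
  proof (rule bern_mono)
    fix J assume J: "J \<subseteq> ?T"
    show "of_bool (type_graph J \<inter> P = F \<and> e \<in> type_graph J)
        \<le> (\<Sum>S\<in>?E. of_bool (S \<in> J) * of_bool (type_graph J \<inter> P = F) :: real)"
    proof (cases "type_graph J \<inter> P = F \<and> e \<in> type_graph J")
      case True
      then obtain S where S: "S \<in> J" "e \<in> clique S" by (auto simp: type_graph_def)
      then have "S \<in> ?E" using J by (auto simp: clique_def)
      then have "of_bool (S \<in> J) * of_bool (type_graph J \<inter> P = F) \<le> (\<Sum>S\<in>?E. of_bool (S \<in> J) * of_bool (type_graph J \<inter> P = F) :: real)"
        by (intro member_le_sum) auto
      then show ?thesis using True S by simp
    next
      case False
      then have *: "of_bool (type_graph J \<inter> P = F \<and> e \<in> type_graph J) = (0 :: real)" by simp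
      show ?thesis unfolding * by (intro sum_nonneg) auto
    qed
  qed (use b in auto)
  also have "\<dots> = (\<Sum>S\<in>?E. b S * bern b ?T (\<lambda>J. of_bool (type_graph (insert S J) \<inter> P = F)))"
    unfolding bern_sum by (intro sum.cong refl bern_mem) auto
  also have "\<dots> \<le> (\<Sum>S\<in>?E. b S * ((1 / q) ^ card (clique S \<inter> F) * hist))"
  proof (intro sum_mono mult_left_mono)
    fix S assume S: "S \<in> ?E"
    let ?Q = "clique S \<inter> F"
    \<comment> \<open>Since \<open>2 \<le> K\<close>, edges are themselves types, so
      \<open>?Q\<close> is also a set of types.\<close>
    have Q: "?Q \<subseteq> ?T" "?Q \<subseteq> all_edges n"
      using assms by (auto simp: types_def all_edges_eq_clique clique_def)
    have tgQ: "type_graph ?Q = ?Q"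
      by (auto simp: type_graph_def clique_edge clique_def[of S])
    \<comment> \<open>Within \<open>P\<close> the clique of \<open>S\<close> can show only edges of
      \<open>F\<close>, namely those in \<open>?Q\<close>. Adding the pairs \<open>?Q\<close> in
      place of \<open>S\<close> shows exactly the same.\<close>
    have "bern b ?T (\<lambda>J. of_bool (type_graph (insert S J) \<inter> P = F)) \<le> bern b ?T (\<lambda>J. of_bool (type_graph (J \<union> ?Q) \<inter> P = F))"
    proof (rule bern_mono)
      fix J
      have "type_graph (J \<union> ?Q) \<inter> P = F" if "type_graph (insert S J) \<inter> P = F"
      proof -
        have "(clique S \<union> type_graph J) \<inter> P = F" using that by (simp add: type_graph_def)
        then show ?thesis unfolding type_graph_Un tgQ by blast
      qed
      then show "of_bool (type_graph (insert S J) \<inter> P = F) \<le> (of_bool (type_graph (J \<union> ?Q) \<inter> P = F) :: real)"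
        by simp
    qed (use b in auto)
    \<comment> \<open>\<open>bern_superset\<close> from right to left: forcing \<open>?Q\<close> in
      amounts to conditioning on it, and each pair has probability \<open>q\<close>. Dropping the
      condition afterwards leaves \<open>hist\<close>.\<close>
    also have "\<dots> = (1 / q) ^ card ?Q * bern b ?T (\<lambda>J. of_bool (?Q \<subseteq> J) * of_bool (type_graph J \<inter> P = F))"
    proof -
      have "(\<Prod>x\<in>?Q. b x) = (\<Prod>x\<in>?Q. q)" using Q q by (intro prod.cong) auto
      then show ?thesis using q
        by (subst bern_superset[OF _ Q(1)]) (auto simp: power_one_over)
    qed
    also have "\<dots> \<le> (1 / q) ^ card ?Q * hist"
      unfolding hist_def using b q by (intro mult_left_mono bern_mono) auto
    finally show "bern b ?T (\<lambda>J. of_bool (type_graph (insert S J) \<inter> P = F)) \<le> (1 / q) ^ card ?Q * hist" .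
  qed (use b in auto)
  finally show ?thesis by (simp only: sum_distrib_right mult.assoc)
qed

section \<open>Codegrees and the total posterior weight of cliques through an edge\<close>

definition common_nbrs :: "nat set set \<Rightarrow> nat \<Rightarrow> nat \<Rightarrow> nat set" where
  "common_nbrs F u v = {w. {u, w} \<in> F \<and> {v, w} \<in> F}"

lemma common_nbrs_subset: "F \<subseteq> all_edges n \<Longrightarrow> common_nbrs F u v \<subseteq> {0..<n} - {u, v}"
  by (auto simp: common_nbrs_def all_edges_eq_clique clique_def)

lemma common_nbrs_mono: "F \<subseteq> F' \<Longrightarrow> common_nbrs F u v \<subseteq> common_nbrs F' u v"
  by (auto simp: common_nbrs_def)

text \<open>Vertices are added one at a time: a vertex with at most one neighbour in the current set \<open>R\<close>
  costs at most \<open>1 / q\<close>, and the others are common neighbours of two vertices of \<open>R\<close>.\<close>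
lemma sum_cliques_through_edge:
  fixes q :: real
  assumes q: "0 < q" "q \<le> 1" and F: "F \<subseteq> all_edges n" and e: "e \<in> all_edges n" "e \<notin> F"
    and D: "\<And>u v. u < n \<Longrightarrow> v < n \<Longrightarrow> u \<noteq> v \<Longrightarrow> card (common_nbrs F u v) \<le> D"
    and "2 \<le> k"
  shows "(\<Sum>S | S \<subseteq> {0..<n} \<and> card S = k \<and> e \<subseteq> S. (1 / q) ^ card (clique S \<inter> F))
    \<le> (\<Prod>r=2..<k. real n / q + real (r ^ 2 * D) / q ^ r)"
  using \<open>2 \<le> k\<close>
proof (induction k rule: dec_induct)
  case base
  have e2: "card e = 2" "e \<subseteq> {0..<n}" using e by (auto simp: all_edges_eq_clique clique_def)
  have "{S. S \<subseteq> {0..<n} \<and> card S = 2 \<and> e \<subseteq> S} = {e}"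
    using e2 card_subset_eq[of _ e] by (auto dest: finite_subset)
  then show ?case using e e2 by (simp add: clique_edge)
next
  case (step k)
  let ?A = "\<lambda>k. {S. S \<subseteq> {0..<n} \<and> card S = k \<and> e \<subseteq> S}"
  let ?g = "\<lambda>S. (1 / q) ^ card (clique S \<inter> F)"
  have e2: "card e = 2" "e \<subseteq> {0..<n}" using e by (auto simp: all_edges_eq_clique clique_def)
  have q1: "1 \<le> 1 / q" using q by simp
  have fin: "finite (?A k)" for k by simp
  let ?B = "SIGMA R:?A k. {0..<n} - R"
  have "(\<Sum>S\<in>?A (Suc k). ?g S) \<le> (\<Sum>(R, w)\<in>?B. ?g (insert w R))"
  proof (rule sum_le_included[where i = "\<lambda>(R, w). insert w R"])
    show "\<forall>S\<in>?A (Suc k). \<exists>z\<in>?B. (case z of (R, w) \<Rightarrow> insert w R) = S \<and> ?g S \<le> (case z of (R, w) \<Rightarrow> ?g (insert w R))"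
    proof
      fix S assume S: "S \<in> ?A (Suc k)"
      then have "finite S" by (auto intro: finite_subset)
      \<comment> \<open>\<open>S\<close> has at least three vertices, so one outside
        \<open>e\<close> can be removed. Reaching the same \<open>S\<close> from several pairs
        \<open>(R, w)\<close> only enlarges the bound.\<close>
      have "\<not> S \<subseteq> e" using S e2 card_mono[of e S] step.hyps by (auto simp: card_ge_0_finite)
      then obtain w where w: "w \<in> S" "w \<notin> e" by auto
      then have "(S - {w}, w) \<in> ?B" "insert w (S - {w}) = S"
        using S \<open>finite S\<close> by auto
      then show "\<exists>z\<in>?B. (case z of (R, w) \<Rightarrow> insert w R) = S \<and> ?g S \<le> (case z of (R, w) \<Rightarrow> ?g (insert w R))"
        by (intro bexI[of _ "(S - {w}, w)"]) auto
    qed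
  qed (use q in auto)
  also have "\<dots> = (\<Sum>R\<in>?A k. \<Sum>w\<in>{0..<n} - R. ?g (insert w R))"
    by (rule sum.Sigma[symmetric]) auto
  also have "\<dots> \<le> (\<Sum>R\<in>?A k. ?g R * (real n / q + real (k ^ 2 * D) / q ^ k))"
  proof (rule sum_mono)
    fix R assume R: "R \<in> ?A k"
    then have finR: "finite R" by (auto intro: finite_subset)
    define deg where "deg w = card {v \<in> R. {w, v} \<in> F}" for w
    define W where "W = {w \<in> {0..<n} - R. 2 \<le> deg w}"
    have degk: "deg w \<le> k" for w
      unfolding deg_def using R card_mono[OF finR, of "{v \<in> R. {w, v} \<in> F}"] by auto
    \<comment> \<open>The known edges gained with \<open>w\<close> join it to \<open>R\<close>. At
      most one costs \<open>1 / q\<close>; more cost at most \<open>(1 / q) ^ k\<close>, paid only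
      by the vertices in \<open>W\<close>.\<close>
    have "(\<Sum>w\<in>{0..<n} - R. ?g (insert w R)) \<le> (\<Sum>w\<in>{0..<n} - R. ?g R * (1 / q + of_bool (w \<in> W) * (1 / q) ^ k))"
    proof (rule sum_mono)
      fix w assume w: "w \<in> {0..<n} - R"
      have "clique (insert w R) \<inter> F \<subseteq> (clique R \<inter> F) \<union> (\<lambda>v. {w, v}) ` {v \<in> R. {w, v} \<in> F}"
      proof
        fix x assume x: "x \<in> clique (insert w R) \<inter> F"
        show "x \<in> (clique R \<inter> F) \<union> (\<lambda>v. {w, v}) ` {v \<in> R. {w, v} \<in> F}"
        proof (cases "w \<in> x")
          case True
          then obtain v where "x = {w, v}" "w \<noteq> v"
            using x by (auto simp: clique_def card_2_iff)
          then show ?thesis using x by (auto simp: clique_def)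
        qed (use x in \<open>auto simp: clique_def\<close>)
      qed
      then have "card (clique (insert w R) \<inter> F) \<le> card ((clique R \<inter> F) \<union> (\<lambda>v. {w, v}) ` {v \<in> R. {w, v} \<in> F})"
        using finR by (intro card_mono) (auto simp: clique_def)
      also have "\<dots> \<le> card (clique R \<inter> F) + card ((\<lambda>v. {w, v}) ` {v \<in> R. {w, v} \<in> F})"
        by (rule card_Un_le)
      also have "\<dots> \<le> card (clique R \<inter> F) + deg w"
        unfolding deg_def using finR by (intro add_left_mono card_image_le) auto
      finally have "?g (insert w R) \<le> (1 / q) ^ (card (clique R \<inter> F) + deg w)"
        using q1 by (intro power_increasing)
      also have "\<dots> = ?g R * (1 / q) ^ deg w" by (simp add: power_add)
      also have "(1 / q) ^ deg w \<le> 1 / q + of_bool (w \<in> W) * (1 / q) ^ k"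
      proof (cases "w \<in> W")
        case True
        have "(1 / q) ^ deg w \<le> (1 / q) ^ k" using q1 degk by (intro power_increasing)
        then show ?thesis using True q by (simp add: add_increasing)
      next
        case False
        then have "deg w \<le> 1" using w by (auto simp: W_def)
        then have "(1 / q) ^ deg w \<le> (1 / q) ^ 1" using q1 by (intro power_increasing)
        then show ?thesis using False by simp
      qed
      finally show "?g (insert w R) \<le> ?g R * (1 / q + of_bool (w \<in> W) * (1 / q) ^ k)"
        using q by (simp add: mult_left_mono)
    qed
    also have "\<dots> = ?g R * (real (card ({0..<n} - R)) / q + real (card W) * (1 / q) ^ k)"
    proof -
      have "(\<Sum>w\<in>{0..<n} - R. of_bool (w \<in> W) * (1 / q) ^ k) = (\<Sum>w\<in>W. (1 / q) ^ k)"
        by (rule sum.mono_neutral_cong_right) (auto simp: W_def)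
      then show ?thesis
        by (simp add: sum_distrib_left[symmetric] sum.distrib)
    qed
    also have "\<dots> \<le> ?g R * (real n / q + real (k ^ 2 * D) * (1 / q) ^ k)"
    proof (intro mult_left_mono add_mono divide_right_mono mult_right_mono)
      show "real (card ({0..<n} - R)) \<le> real n"
        using card_mono[of "{0..<n}" "{0..<n} - R"] by simp
      have finUV: "finite {(u, v) \<in> R \<times> R. u \<noteq> v}"
        by (rule finite_subset[of _ "R \<times> R"]) (use finR in auto)
      have "W \<subseteq> (\<Union>(u, v)\<in>{(u, v) \<in> R \<times> R. u \<noteq> v}. common_nbrs F u v)"
      proof
        fix w assume "w \<in> W"
        then have "\<not> card {v \<in> R. {w, v} \<in> F} \<le> Suc 0" by (auto simp: W_def deg_def)
        then obtain u v where "u \<in> R" "v \<in> R" "u \<noteq> v" "{w, u} \<in> F" "{w, v} \<in> F"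
          using finR by (subst (asm) card_le_Suc0_iff_eq) auto
        then show "w \<in> (\<Union>(u, v)\<in>{(u, v) \<in> R \<times> R. u \<noteq> v}. common_nbrs F u v)"
          by (auto simp: common_nbrs_def insert_commute)
      qed
      then have "card W \<le> card (\<Union>(u, v)\<in>{(u, v) \<in> R \<times> R. u \<noteq> v}. common_nbrs F u v)"
        using finR by (intro card_mono finite_UN_I)
          (auto intro: finite_subset[OF common_nbrs_subset[OF F]] finite_subset[of _ "R \<times> R"])
      also have "\<dots> \<le> (\<Sum>(u, v)\<in>{(u, v) \<in> R \<times> R. u \<noteq> v}. card (common_nbrs F u v))"
        using card_UN_le[OF finUV, of "\<lambda>(u, v). common_nbrs F u v"]
        by (simp add: case_prod_unfold)
      also have "\<dots> \<le> (\<Sum>(u, v)\<in>{(u, v) \<in> R \<times> R. u \<noteq> v}. D)"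
        using R D by (intro sum_mono) (auto simp: subset_iff)
      also have "\<dots> = card {(u, v) \<in> R \<times> R. u \<noteq> v} * D" by simp
      also have "\<dots> \<le> card (R \<times> R) * D"
        using finR by (intro mult_right_mono card_mono) auto
      also have "\<dots> = k ^ 2 * D" using R by (simp add: card_cartesian_product power2_eq_square)
      finally show "real (card W) \<le> real (k ^ 2 * D)" by (simp only: of_nat_le_iff)
    qed (use q in auto)
    finally show "(\<Sum>w\<in>{0..<n} - R. ?g (insert w R)) \<le> ?g R * (real n / q + real (k ^ 2 * D) / q ^ k)"
      by (simp add: power_one_over)
  qed
  also have "\<dots> = (\<Sum>R\<in>?A k. ?g R) * (real n / q + real (k ^ 2 * D) / q ^ k)"
    by (rule sum_distrib_right[symmetric])
  also have "\<dots> \<le> (\<Prod>r=2..<k. real n / q + real (r ^ 2 * D) / q ^ r) * (real n / q + real (k ^ 2 * D) / q ^ k)"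
    using q by (intro mult_right_mono step.IH) auto
  also have "\<dots> = (\<Prod>r=2..<Suc k. real n / q + real (r ^ 2 * D) / q ^ r)"
    using step.hyps by (simp add: prod.atLeastLessThan_Suc)
  finally show ?case .
qed

definition large_codegree :: "nat \<Rightarrow> nat \<Rightarrow> nat set set set" where
  "large_codegree n d = {F \<in> Pow (all_edges n). \<exists>u<n. \<exists>v<n. u \<noteq> v \<and> d \<le> card (common_nbrs F u v)}"

lemma large_codegree_mono:
  assumes "F \<in> large_codegree n d" "F \<subseteq> F'" "F' \<subseteq> all_edges n"
  shows "F' \<in> large_codegree n d"
proof -
  have "card (common_nbrs F u v) \<le> card (common_nbrs F' u v)" for u v
    using common_nbrs_subset[OF assms(3)] common_nbrs_mono[OF assms(2)]
    by (intro card_mono) (auto intro: finite_subset)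
  then show ?thesis using assms by (fastforce simp: large_codegree_def intro: le_trans)
qed

text \<open>Union bound over \<open>u\<close>, \<open>v\<close> and a \<open>d\<close>-set
  \<open>W\<close> of common neighbours. The two stars from \<open>u\<close> and \<open>v\<close> to
  \<open>W\<close> are disjoint, hence the exponent \<open>2 * d\<close>.\<close>

lemma prob_large_codegree:
  assumes Q: "0 \<le> Q" "Q \<le> 1"
  shows "bern (\<lambda>_. Q) (all_edges n) (\<lambda>E. of_bool (E \<in> large_codegree n d)) \<le> real n ^ 2 * (real (n choose d) * Q ^ (2 * d))"
proof -
  let ?UV = "{(u, v) \<in> {0..<n} \<times> {0..<n}. u \<noteq> v}"
  let ?W = "\<lambda>u v. {W. W \<subseteq> {0..<n} - {u, v} \<and> card W = d}"
  let ?s = "\<lambda>u v W. (\<lambda>w. {u, w}) ` W \<union> (\<lambda>w. {v, w}) ` W"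
  have finUV: "finite ?UV" by (rule finite_subset[of _ "{0..<n} \<times> {0..<n}"]) auto
  have "bern (\<lambda>_. Q) (all_edges n) (\<lambda>E. of_bool (E \<in> large_codegree n d))
      \<le> bern (\<lambda>_. Q) (all_edges n) (\<lambda>E. \<Sum>(u, v)\<in>?UV. \<Sum>W\<in>?W u v. of_bool (?s u v W \<subseteq> E) * 1)"
  proof (rule bern_mono)
    fix E assume E: "E \<subseteq> all_edges n"
    show "of_bool (E \<in> large_codegree n d) \<le> (\<Sum>(u, v)\<in>?UV. \<Sum>W\<in>?W u v. of_bool (?s u v W \<subseteq> E) * 1 :: real)"
    proof (cases "E \<in> large_codegree n d")
      case True
      then obtain u v where uv: "u < n" "v < n" "u \<noteq> v" "d \<le> card (common_nbrs E u v)"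
        by (auto simp: large_codegree_def)
      then obtain W where W: "W \<subseteq> common_nbrs E u v" "card W = d" by (meson obtain_subset_with_card_n)
      then have W': "W \<in> ?W u v" using common_nbrs_subset[OF E] by auto
      have "1 = (of_bool (?s u v W \<subseteq> E) * 1 :: real)" using W by (auto simp: common_nbrs_def)
      also have "\<dots> \<le> (\<Sum>W\<in>?W u v. of_bool (?s u v W \<subseteq> E) * 1)"
        by (rule member_le_sum[OF W']) auto
      also have "\<dots> \<le> (\<Sum>(u, v)\<in>?UV. \<Sum>W\<in>?W u v. of_bool (?s u v W \<subseteq> E) * 1)"
        using member_le_sum[of "(u, v)" ?UV "\<lambda>(u, v). \<Sum>W\<in>?W u v. of_bool (?s u v W \<subseteq> E) * 1 :: real"] uv finUV
        by (auto simp: sum_nonneg)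
      finally show ?thesis using True by simp
    qed (auto intro!: sum_nonneg)
  qed (use Q in auto)
  also have "\<dots> = (\<Sum>(u, v)\<in>?UV. \<Sum>W\<in>?W u v. bern (\<lambda>_. Q) (all_edges n) (\<lambda>E. of_bool (?s u v W \<subseteq> E) * 1))"
    by (simp only: bern_sum case_prod_unfold)
  also have "\<dots> = (\<Sum>(u, v)\<in>?UV. \<Sum>W\<in>?W u v. Q ^ (2 * d))"
  proof (intro sum.cong refl)
    fix uv assume "uv \<in> ?UV"
    then obtain u v where uv: "uv = (u, v)" "u < n" "v < n" "u \<noteq> v" by auto
    have "bern (\<lambda>_. Q) (all_edges n) (\<lambda>E. of_bool (?s u v W \<subseteq> E) * 1) = Q ^ (2 * d)" if W: "W \<in> ?W u v" for W
    proof -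
      have finW: "finite W" using W by (auto intro: finite_subset)
      have sub: "?s u v W \<subseteq> all_edges n"
        using W uv unfolding all_edges_eq_clique clique_def by (auto simp: card_insert_if subset_iff)
      have "card (?s u v W) = card ((\<lambda>w. {u, w}) ` W) + card ((\<lambda>w. {v, w}) ` W)"
        using finW W uv by (intro card_Un_disjoint) (auto simp: doubleton_eq_iff)
      also have "\<dots> = 2 * d"
        using W by (subst (1 2) card_image) (auto simp: inj_on_def doubleton_eq_iff)
      finally show ?thesis by (subst bern_superset[OF _ sub]) auto
    qed
    then show "(case uv of (u, v) \<Rightarrow> \<Sum>W\<in>?W u v. bern (\<lambda>_. Q) (all_edges n) (\<lambda>E. of_bool (?s u v W \<subseteq> E) * 1))
        = (case uv of (u, v) \<Rightarrow> \<Sum>W\<in>?W u v. Q ^ (2 * d))"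
      using uv by simp
  qed
  also have "\<dots> \<le> (\<Sum>(u, v)\<in>?UV. real (n choose d) * Q ^ (2 * d))"
  proof (intro sum_mono)
    fix uv assume "uv \<in> ?UV"
    obtain u v where uv: "uv = (u, v)" by (cases uv)
    have "card (?W u v) \<le> card {W. W \<subseteq> {0..<n} \<and> card W = d}" by (intro card_mono) auto
    also have "\<dots> = n choose d" using n_subsets[of "{0..<n}" d] by simp
    finally have "real (card (?W u v)) * Q ^ (2 * d) \<le> real (n choose d) * Q ^ (2 * d)"
      using Q by (intro mult_right_mono) auto
    then show "(case uv of (u, v) \<Rightarrow> \<Sum>W\<in>?W u v. Q ^ (2 * d)) \<le> (case uv of (u, v) \<Rightarrow> real (n choose d) * Q ^ (2 * d))"
      using uv by simp
  qed
  also have "\<dots> = real (card ?UV) * (real (n choose d) * Q ^ (2 * d))" by simp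
  also have "\<dots> \<le> real n ^ 2 * (real (n choose d) * Q ^ (2 * d))"
  proof (intro mult_right_mono)
    have "card ?UV \<le> card ({0..<n} \<times> {0..<n})" by (intro card_mono) auto
    also have "\<dots> = n ^ 2" by (simp add: power2_eq_square)
    finally show "real (card ?UV) \<le> real n ^ 2" by (simp flip: of_nat_power)
  qed (use Q in auto)
  finally show ?thesis .
qed

text \<open>The left side of \<open>main\<close> combines \<open>type_posterior\<close> and
  \<open>sum_cliques_through_edge\<close> over all clique sizes, so it bounds the next edge in every
  history with codegrees at most \<open>d\<close>. The error terms pay for larger codegrees and for
  objects with more than \<open>K\<close> choosers.\<close>

lemma rig_le_gnp:
  fixes p Q c :: real and n m d K :: nat and r :: "nat \<Rightarrow> real"
  assumes p: "0 < p" "p < 1" and c: "0 < c" "c \<le> bern (\<lambda>_. p) {0..<n} (\<lambda>V. of_bool (card V \<le> 1))"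
    and r: "\<And>k. 2 \<le> k \<Longrightarrow> k \<le> K \<Longrightarrow> p ^ k * (1 - p) ^ (n - k) \<le> r k * c \<and> r k \<le> 1"
    and K: "2 \<le> K" and "0 < m"
    and Q: "Q \<le> 1"
  defines "b \<equiv> \<lambda>k. 1 - (1 - r k) ^ m"
  assumes main: "(\<Sum>k=2..K. b k * (\<Prod>r=2..<k. real n / b 2 + real (r ^ 2 * d) / b 2 ^ r)) \<le> Q"
    and mono: "\<And>G G'. G \<in> P \<Longrightarrow> G \<subseteq> G' \<Longrightarrow> G' \<subseteq> all_edges n \<Longrightarrow> G' \<in> P"
  shows "rig_prob n m p P \<le> gnp_prob n Q P + real n ^ 2 * (real (n choose Suc d) * Q ^ (2 * Suc d)) + m * (real n * p) ^ Suc K"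
proof -
  let ?T = "types K n" and ?X = "all_edges n" and ?bad = "large_codegree n (Suc d)"
  define q where "q = b 2"
  have r01: "0 < r k \<and> r k \<le> 1" if "2 \<le> k" "k \<le> K" for k
  proof -
    have "0 < p ^ k * (1 - p) ^ (n - k)" using p by simp
    then have "0 < r k * c" using r[OF that] by linarith
    then show ?thesis using c r[OF that] by (simp add: zero_less_mult_iff)
  qed
  have b01: "0 < b k \<and> b k \<le> 1" if "2 \<le> k" "k \<le> K" for k
  proof -
    have "(1 - r k) ^ m < 1"
      using r01[OF that] \<open>0 < m\<close> by (intro power_less_one_iff[THEN iffD2]) auto
    then show ?thesis using r01[OF that] by (auto simp: b_def)
  qed
  have q: "0 < q" "q \<le> 1" using b01[of 2] K by (auto simp: q_def)
  have bT: "0 \<le> b (card S) \<and> b (card S) \<le> 1" if "S \<in> ?T" for S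
    using b01[of "card S"] that by (auto simp: types_def)
  have Q0: "0 \<le> Q"
  proof -
    have "0 \<le> (\<Sum>k=2..K. b k * (\<Prod>r=2..<k. real n / b 2 + real (r ^ 2 * d) / b 2 ^ r))"
      using b01 q unfolding q_def
      by (intro sum_nonneg mult_nonneg_nonneg prod_nonneg ballI add_nonneg_nonneg divide_nonneg_nonneg)
         (auto intro: less_imp_le)
    then show ?thesis using main by linarith
  qed
  \<comment> \<open>After a bad history \<open>F\<close> both \<open>H\<close> and
    \<open>insert e H\<close> are bad, since they contain \<open>F\<close>; the increment of
    \<open>f\<close> is then 0 and the step is trivial.\<close>
  define f where "f G = (of_bool (G \<in> P \<or> G \<in> ?bad) :: real)" for G
  have fmono: "f G \<le> f G'" if "G \<subseteq> G'" "G' \<subseteq> ?X" for G G'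
    using mono[of G G'] large_codegree_mono[of G n "Suc d" G'] that by (auto simp: f_def)
  have "rig_prob n m p P \<le> bern (\<lambda>_. p) ({0..<n} \<times> {0..<m}) (\<lambda>S. f (object_graph clique n m S))"
    unfolding rig_prob_eq_bern using p by (intro bern_mono) (auto simp: f_def)
  also have "\<dots> \<le> m * (real n * p) ^ Suc K + bern (\<lambda>S. b (card S)) ?T (\<lambda>J. f (type_graph J))"
    unfolding b_def by (rule objects_le_types[OF _ _ c r]) (use p fmono in \<open>auto simp: f_def\<close>)
  also have "bern (\<lambda>S. b (card S)) ?T (\<lambda>J. f (type_graph J)) \<le> bern (\<lambda>_. Q) ?X f"
  proof (rule bern_sequential_comparison)
    fix E e F H
    assume A: "E \<subseteq> ?X" "e \<in> ?X" "e \<notin> E" "F \<subseteq> E" "H \<subseteq> ?X" "e \<notin> H" "H \<inter> E = F"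
    define hist where "hist = bern (\<lambda>S. b (card S)) ?T (\<lambda>J. of_bool (type_graph J \<inter> E = F))"
    have hist0: "0 \<le> hist" unfolding hist_def using bT by (intro bern_nonneg) auto
    show "0 \<le> (Q * bern (\<lambda>S. b (card S)) ?T (\<lambda>J. of_bool (type_graph J \<inter> E = F)) -
            bern (\<lambda>S. b (card S)) ?T (\<lambda>J. of_bool (type_graph J \<inter> E = F \<and> e \<in> type_graph J))) *
           (f (insert e H) - f H)"
    proof (cases "F \<in> ?bad")
      case True
      then have "H \<in> ?bad" "insert e H \<in> ?bad"
        using A by (auto elim!: large_codegree_mono)
      then show ?thesis by (simp add: f_def)
    next
      case False
      have FX: "F \<subseteq> ?X" "e \<notin> F" using A by auto
      have D: "card (common_nbrs F u v) \<le> d" if "u < n" "v < n" "u \<noteq> v" for u v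
        using False FX that by (force simp: large_codegree_def not_le)
      have "bern (\<lambda>S. b (card S)) ?T (\<lambda>J. of_bool (type_graph J \<inter> E = F \<and> e \<in> type_graph J))
         \<le> (\<Sum>S | S \<in> ?T \<and> e \<subseteq> S. b (card S) * (1 / q) ^ card (clique S \<inter> F)) * hist"
        unfolding hist_def
        by (rule type_posterior[OF K]) (use A bT q in \<open>auto simp: q_def all_edges_eq_clique clique_def\<close>)
      also have "(\<Sum>S | S \<in> ?T \<and> e \<subseteq> S. b (card S) * (1 / q) ^ card (clique S \<inter> F))
          = (\<Sum>k=2..K. \<Sum>S\<in>{S \<in> {S \<in> ?T. e \<subseteq> S}. card S = k}. b (card S) * (1 / q) ^ card (clique S \<inter> F))"
        by (rule sum.group[symmetric]) (auto simp: types_def)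
      also have "\<dots> = (\<Sum>k=2..K. b k * (\<Sum>S | S \<subseteq> {0..<n} \<and> card S = k \<and> e \<subseteq> S. (1 / q) ^ card (clique S \<inter> F)))"
      proof (rule sum.cong[OF refl])
        fix k assume "k \<in> {2..K}"
        then have "{S \<in> {S \<in> ?T. e \<subseteq> S}. card S = k} = {S. S \<subseteq> {0..<n} \<and> card S = k \<and> e \<subseteq> S}"
          by (auto simp: types_def)
        then show "(\<Sum>S\<in>{S \<in> {S \<in> ?T. e \<subseteq> S}. card S = k}. b (card S) * (1 / q) ^ card (clique S \<inter> F))
            = b k * (\<Sum>S | S \<subseteq> {0..<n} \<and> card S = k \<and> e \<subseteq> S. (1 / q) ^ card (clique S \<inter> F))"
          by (simp add: sum_distrib_left)
      qed
      also have "\<dots> \<le> (\<Sum>k=2..K. b k * (\<Prod>r=2..<k. real n / q + real (r ^ 2 * d) / q ^ r))"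
        using b01 A FX q D
        by (intro sum_mono mult_left_mono sum_cliques_through_edge) (auto intro: less_imp_le)
      also have "\<dots> \<le> Q" using main by (simp add: q_def)
      finally have "bern (\<lambda>S. b (card S)) ?T (\<lambda>J. of_bool (type_graph J \<inter> E = F \<and> e \<in> type_graph J)) \<le> Q * hist"
        using hist0 by (simp add: mult_right_mono)
      then show ?thesis
        using fmono[of H "insert e H"] A by (intro mult_nonneg_nonneg) (auto simp: hist_def)
    qed
  qed (use bT Q Q0 type_graph_subset in auto)
  also have "bern (\<lambda>_. Q) ?X f \<le> bern (\<lambda>_. Q) ?X (\<lambda>G. of_bool (G \<in> P) + of_bool (G \<in> ?bad))"
    by (rule bern_mono) (use Q Q0 in \<open>auto simp: f_def\<close>)
  also have "\<dots> = gnp_prob n Q P + bern (\<lambda>_. Q) ?X (\<lambda>G. of_bool (G \<in> ?bad))"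
    using Q Q0 by (simp add: bern_add gnp_prob_eq_bern)
  also have "bern (\<lambda>_. Q) ?X (\<lambda>G. of_bool (G \<in> ?bad)) \<le> real n ^ 2 * (real (n choose Suc d) * Q ^ (2 * Suc d))"
    by (rule prob_large_codegree[OF Q0 Q])
  finally show ?thesis by simp
qed

subsection \<open>Edge probabilities\<close>

text \<open>Concavity of 1 - exp(-x), which vanishes at 0. It converts a factor in the exponent into
  a factor in front of the edge probability.\<close>

lemma one_minus_exp_scale:
  fixes t x :: real
  assumes "0 \<le> t" "t \<le> 1"
  shows "t * (1 - exp (- x)) \<le> 1 - exp (- (t * x))"
proof -
  have "exp ((1 - t) *\<^sub>R 0 + t *\<^sub>R (- x)) \<le> (1 - t) * exp 0 + t * exp (- x)"
    by (rule convex_onD[OF exp_convex]) (use assms in auto)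
  then show ?thesis by (simp add: algebra_simps)
qed

lemma one_minus_power_le_exp:
  fixes y :: real
  assumes "y \<le> 1" shows "(1 - y) ^ k \<le> exp (- (k * y))"
proof -
  have "(1 - y) ^ k \<le> exp (- y) ^ k"
    using assms exp_ge_add_one_self[of "- y"] by (intro power_mono) auto
  then show ?thesis by (simp add: exp_of_nat_mult[symmetric])
qed

text \<open>1 - y is the reciprocal of 1 + y/(1-y), and the latter is at most exp(y/(1-y)).\<close>

lemma exp_le_one_minus_power:
  fixes y :: real
  assumes "0 \<le> y" "y < 1" shows "exp (- (k * (y / (1 - y)))) \<le> (1 - y) ^ k"
proof -
  have "1 / (1 - y) \<le> exp (y / (1 - y))"
    using exp_ge_add_one_self[of "y / (1 - y)"] assms by (simp add: field_simps)
  then have "exp (- (y / (1 - y))) \<le> 1 - y"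
    using assms by (simp add: exp_minus field_simps)
  then have "exp (- (y / (1 - y))) ^ k \<le> (1 - y) ^ k" by (intro power_mono) auto
  then show ?thesis by (simp add: exp_of_nat_mult[symmetric])
qed

lemma power_div_fact_le_exp:
  fixes x :: real
  assumes "0 \<le> x" shows "x ^ k / fact k \<le> exp x"
proof -
  have s: "(\<lambda>n. x ^ n / fact n) sums exp x"
    using exp_converges[of x] by (simp add: divide_inverse_commute)
  have "(\<Sum>n\<in>{k}. x ^ n / fact n) \<le> (\<Sum>n. x ^ n / fact n)"
    by (rule sum_le_suminf) (use s assms in \<open>auto simp: sums_iff\<close>)
  then show ?thesis using s by (simp add: sums_iff)
qed

lemma gnp_prob_mono:
  assumes "q \<le> q'" and "\<And>G G'. G \<in> P \<Longrightarrow> G \<subseteq> G' \<Longrightarrow> G' \<subseteq> all_edges n \<Longrightarrow> G' \<in> P"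
  shows "gnp_prob n q P \<le> gnp_prob n q' P"
  unfolding gnp_prob_eq_bern by (rule bern_mono_prob) (use assms in auto)

lemma gnp_prob_ge_1:
  assumes "1 \<le> q" shows "gnp_prob n q P = of_bool (all_edges n \<in> P)"
proof -
  have "gnp_prob n q P = bern (\<lambda>_. 1) (all_edges n) (\<lambda>E. of_bool (E \<in> P))"
    using assms by (simp add: gnp_prob_eq_bern)
  also have "\<dots> = (\<Sum>E\<in>Pow (all_edges n). if E = all_edges n then of_bool (all_edges n \<in> P) else 0)"
    unfolding bern_def
  proof (intro sum.cong refl)
    fix E assume E: "E \<in> Pow (all_edges n)"
    show "(\<Prod>x\<in>E. 1) * (\<Prod>x\<in>all_edges n - E. 1 - 1) * of_bool (E \<in> P)
        = (if E = all_edges n then of_bool (all_edges n \<in> P) else (0::real))"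
      using E by (auto simp: card_gt_0_iff)
  qed
  also have "\<dots> = of_bool (all_edges n \<in> P)" by (simp add: sum.delta)
  finally show ?thesis .
qed

text \<open>This is q_2. The number of objects chosen by exactly a given pair is binomial with mean
  m p^2 (1-p)^(n-2), and q_2 is the probability that a Poisson variable of that mean is
  nonzero.\<close>

definition edge_prob :: "nat \<Rightarrow> nat \<Rightarrow> real \<Rightarrow> real" where
  "edge_prob n m p = 1 - exp (- (real m * p ^ 2 * (1 - p) ^ (n - 2)))"

text \<open>Discarding at most n^2 of at least n^3 objects keeps a fraction \<open>t\<close> of at
  least 1 - 1/n in the exponent, and by concavity at least this fraction of the edge
  probability.\<close>

lemma rig_lower:
  assumes p: "0 \<le> p" "p \<le> 1" and n: "0 < n" "n ^ 3 \<le> m"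
    and mono: "\<And>G G'. G \<in> P \<Longrightarrow> G \<subseteq> G' \<Longrightarrow> G' \<subseteq> all_edges n \<Longrightarrow> G' \<in> P"
  shows "gnp_prob n ((1 + - (1 / n)) * edge_prob n m p) P \<le> rig_prob n m p P"
proof -
  define p2 where "p2 = p ^ 2 * (1 - p) ^ (n - 2)"
  define N where "N = card (all_edges n)"
  define t where "t = real (m - N) / m"
  have m: "0 < m" using n by (metis bot_nat_0.not_eq_extremum le_zero_eq power_not_zero)
  have "N \<le> n ^ 2"
    unfolding N_def card_all_edges using binomial_fact_pow[of n 2] by simp
  moreover have "n ^ 2 \<le> n ^ 3" using n by (intro power_increasing) auto
  ultimately have "N \<le> m" using n by linarith
  have t: "0 \<le> t" "t \<le> 1" using m by (auto simp: t_def)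
  have "real N * n \<le> real (n ^ 2) * n"
    using \<open>N \<le> n ^ 2\<close> by (intro mult_right_mono) auto
  also have "\<dots> = real (n ^ 3)" by (simp add: power3_eq_cube power2_eq_square)
  also have "\<dots> \<le> m" using n by (simp only: of_nat_le_iff)
  finally have "1 - 1 / n \<le> t"
    using n m \<open>N \<le> m\<close> by (simp add: t_def of_nat_diff field_simps)
  have p2: "0 \<le> p2" "p2 \<le> 1" using p by (auto simp: p2_def intro!: mult_le_one power_le_one)
  have "(1 + - (1 / n)) * edge_prob n m p \<le> t * (1 - exp (- (m * p2)))"
    unfolding edge_prob_def p2_def[symmetric] mult.assoc using p2 \<open>1 - 1 / n \<le> t\<close>
    by (intro mult_right_mono) auto
  also have "\<dots> \<le> 1 - exp (- (t * (m * p2)))" by (rule one_minus_exp_scale[OF t])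
  also have "t * (m * p2) = (m - N) * p2" using m by (simp add: t_def)
  also have "1 - exp (- ((m - N) * p2)) \<le> 1 - (1 - p2) ^ (m - N)"
    using one_minus_power_le_exp[OF p2(2), of "m - N"] by simp
  finally have "gnp_prob n ((1 + - (1 / n)) * edge_prob n m p) P \<le> gnp_prob n (1 - (1 - p2) ^ (m - N)) P"
    by (rule gnp_prob_mono[OF _ mono])
  also have "\<dots> \<le> rig_prob n m p P"
    unfolding p2_def N_def by (rule gnp_le_rig[OF p mono])
  finally show ?thesis .
qed

text \<open>The clamping of the edge probability makes the case \<open>(1 + \<epsilon>) * edge_prob n m p \<ge> 1\<close> trivial;
  otherwise \<open>m * p\<^sup>2\<close> is bounded in terms of \<open>\<epsilon>\<close>.\<close>
lemma rig_upper:
  fixes p \<epsilon> x :: real and n m d K :: nat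
  assumes \<epsilon>: "0 < \<epsilon>" "\<epsilon> \<le> 1" and p: "0 < p" and np: "(real n * p) ^ 2 \<le> \<epsilon> / 16" "real n * p \<le> 1 / 2" and "2 \<le> n" "0 < m"
    and K: "2 \<le> K" "K \<le> 6"
    and mono: "\<And>G G'. G \<in> P \<Longrightarrow> G \<subseteq> G' \<Longrightarrow> G' \<subseteq> all_edges n \<Longrightarrow> G' \<in> P"
  defines "x \<equiv> real m * p ^ 2"
  assumes S: "x \<le> 4 / \<epsilon> \<Longrightarrow>
      (\<Sum>k=3..K. \<Prod>r=2..<k. 36 * (4 / \<epsilon>) ^ 5 * (real n * p / x + d * p / x ^ r)) \<le> \<epsilon> ^ 2 / 16"
    and E: "x \<le> 4 / \<epsilon> \<Longrightarrow>
      real n ^ 2 * ((4 * real n * x ^ 2) ^ Suc d / fact (Suc d)) + m * (real n * p) ^ Suc K \<le> \<epsilon>"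
  shows "rig_prob n m p P \<le> gnp_prob n ((1 + \<epsilon>) * edge_prob n m p) P + \<epsilon>"
proof (cases "1 \<le> (1 + \<epsilon>) * edge_prob n m p")
  case True
  have "p \<le> real n * p" using p \<open>2 \<le> n\<close> by simp
  then have p1: "p \<le> 1" using np by linarith
  have "rig_prob n m p P \<le> bern (\<lambda>_. p) ({0..<n} \<times> {0..<m}) (\<lambda>S. of_bool (all_edges n \<in> P))"
    unfolding rig_prob_eq_bern
  proof (rule bern_mono)
    fix S
    have "object_graph clique n m S \<subseteq> all_edges n"
      by (rule object_graph_subset) (rule clique_subset_all_edges)
    then show "of_bool (object_graph clique n m S \<in> P) \<le> (of_bool (all_edges n \<in> P) :: real)"
      using mono by auto
  qed (use p p1 in auto)
  then show ?thesis using True \<epsilon> by (simp add: gnp_prob_ge_1)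
next
  case False
  define q2 where "q2 = edge_prob n m p"
  define p2 where "p2 = p ^ 2 * (1 - p) ^ (n - 2)"
  define l where "l = real m * p2"
  \<comment> \<open>Lower bound for the probability that an object has at most one chooser: two or
    more have probability at most \<open>(real n * p) ^ 2\<close>.\<close>
  define c where "c = 1 - (real n * p) ^ 2"
  \<comment> \<open>Pairs need a sharp rate, because their total must stay within a factor 1 +
    \<epsilon>/2 of q_2. Larger cliques are negligible, so they can afford the factor 2 that covers
    \<open>1 / c\<close>.\<close>
  define r where "r k = (if k = 2 then p2 / c else 2 * p ^ k)" for k
  define b where "b k = 1 - (1 - r k) ^ m" for k
  have pn: "p \<le> real n * p" using p \<open>2 \<le> n\<close> by simp
  have p2n: "p ^ 2 \<le> (real n * p) ^ 2" using pn p by (intro power_mono) auto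
  have p1: "p \<le> 1 / 2" using pn np by linarith
  have x0: "0 < x" using p \<open>0 < m\<close> by (simp add: x_def)
  have q2l: "q2 = 1 - exp (- l)" by (simp add: q2_def edge_prob_def l_def p2_def mult_ac)
  have half: "1 / 2 \<le> (1 - p) ^ (n - 2)"
  proof -
    have "1 + real (n - 2) * (- p) \<le> (1 + - p) ^ (n - 2)"
      using p1 by (intro Bernoulli_inequality) auto
    moreover have "real (n - 2) * p \<le> real n * p" using p by (intro mult_right_mono) auto
    ultimately show ?thesis using np by simp
  qed
  have p2: "0 < p2" "p2 \<le> p ^ 2" "p ^ 2 / 2 \<le> p2"
  proof -
    show "0 < p2" using p p1 by (simp add: p2_def)
    have "p ^ 2 * (1 - p) ^ (n - 2) \<le> p ^ 2 * 1"
      using p p1 by (intro mult_left_mono power_le_one) auto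
    then show "p2 \<le> p ^ 2" by (simp add: p2_def)
    have "p ^ 2 * (1 / 2) \<le> p ^ 2 * (1 - p) ^ (n - 2)"
      using half by (intro mult_left_mono) auto
    then show "p ^ 2 / 2 \<le> p2" by (simp add: p2_def)
  qed
  have l: "0 < l" "l \<le> x" "x / 2 \<le> l"
  proof -
    show "0 < l" using p2 \<open>0 < m\<close> by (simp add: l_def)
    show "l \<le> x" unfolding l_def x_def using p2 by (intro mult_left_mono) auto
    have "real m * (p ^ 2 / 2) \<le> real m * p2" using p2 by (intro mult_left_mono) auto
    then show "x / 2 \<le> l" by (simp add: l_def x_def)
  qed
  have q2: "0 < q2" "q2 \<le> x" "q2 * (1 + \<epsilon>) < 1"
  proof -
    show "0 < q2" using l by (simp add: q2l)
    show "q2 \<le> x" using exp_ge_add_one_self[of "- l"] l by (simp add: q2l)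
    show "q2 * (1 + \<epsilon>) < 1" using False by (simp add: q2_def mult.commute)
  qed
  \<comment> \<open>Linear lower bound for \<open>q2\<close>: being below 1/(1+\<epsilon>) keeps
    exp(-l) above \<epsilon>/2, and 1 - exp(-l) is at least l exp(-l) with l at least x/2.\<close>
  have q2x: "\<epsilon> / 4 * x \<le> q2"
  proof -
    have "\<epsilon> / 2 * (1 + \<epsilon>) \<le> \<epsilon>" using \<epsilon> by (simp add: algebra_simps)
    then have "\<epsilon> / 2 \<le> 1 - q2"
    proof -
      have "\<epsilon> \<le> (1 - q2) * (1 + \<epsilon>)"
        using q2 by (simp add: algebra_simps)
      then have "\<epsilon> / 2 * (1 + \<epsilon>) \<le> (1 - q2) * (1 + \<epsilon>)"
        by (rule order_trans[OF \<open>\<epsilon> / 2 * (1 + \<epsilon>) \<le> \<epsilon>\<close>])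
      then show ?thesis using \<epsilon> by (simp add: mult_le_cancel_right)
    qed
    then have "\<epsilon> / 2 \<le> exp (- l)" by (simp add: q2l)
    moreover have "l * exp (- l) \<le> 1 - exp (- l)"
      using exp_ge_add_one_self[of l] by (simp add: exp_minus field_simps)
    ultimately have "l * (\<epsilon> / 2) \<le> q2"
      using l mult_left_mono[of "\<epsilon> / 2" "exp (- l)" l] unfolding q2l by linarith
    moreover have "x / 2 * (\<epsilon> / 2) \<le> l * (\<epsilon> / 2)"
      using l \<epsilon> by (intro mult_right_mono) auto
    ultimately show ?thesis by (simp add: mult.commute)
  qed
  have x: "x \<le> 4 / \<epsilon>"
  proof -
    have "q2 * 1 \<le> q2 * (1 + \<epsilon>)" using q2 \<epsilon> by (intro mult_left_mono) auto
    then have "\<epsilon> / 4 * x \<le> 1" using q2x q2 by linarith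
    then show ?thesis using \<epsilon> by (simp add: field_simps)
  qed
  have c: "1 / 2 \<le> c" "c \<le> 1" "1 - \<epsilon> / 16 \<le> c" using np \<epsilon> by (auto simp: c_def)
  have y: "0 < p2 / c" "p2 / c \<le> 1 / 2"
  proof -
    show "0 < p2 / c" using p2 c by simp
    have "p2 \<le> \<epsilon> / 16" using p2 p2n np by linarith
    then have "p2 \<le> 1 / 16" using \<epsilon> by linarith
    then show "p2 / c \<le> 1 / 2" using c by (simp add: field_simps)
  qed
  \<comment> \<open>Half of the slack \<epsilon> is spent on pairs here; the other half is left for
    all larger cliques.\<close>
  have b2_upper: "b 2 \<le> (1 + \<epsilon> / 2) * q2"
  proof -
    define s where "s = 1 + \<epsilon> / 2"
    have s: "1 < s" using \<epsilon> by (simp add: s_def)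
    have "p2 / c / (1 - p2 / c) = p2 / (c - p2)"
      using c y by (simp add: field_simps)
    also have "\<dots> \<le> p2 * s"
    proof -
      have "p2 \<le> \<epsilon> / 16" using p2 p2n np by linarith
      then have *: "1 - \<epsilon> / 8 \<le> c - p2" using c by linarith
      have "1 \<le> (1 - \<epsilon> / 8) * s"
        using \<epsilon> mult_left_le[of \<epsilon> \<epsilon>] by (simp add: s_def algebra_simps)
      also have "\<dots> \<le> (c - p2) * s" using * s by (intro mult_right_mono) auto
      finally have "1 \<le> (c - p2) * s" .
      moreover have "0 < c - p2" using * \<epsilon> by linarith
      ultimately have "1 / (c - p2) \<le> s" by (simp add: field_simps)
      then show ?thesis using p2 mult_left_mono[of "1 / (c - p2)" s p2] by simp
    qed
    finally have "real m * (p2 / c / (1 - p2 / c)) \<le> s * l"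
      using mult_left_mono[of "p2 / c / (1 - p2 / c)" "p2 * s" "real m"] by (simp add: l_def mult_ac)
    then have "exp (- (s * l)) \<le> exp (- (real m * (p2 / c / (1 - p2 / c))))" by simp
    also have "\<dots> \<le> (1 - p2 / c) ^ m" by (rule exp_le_one_minus_power) (use y in linarith)+
    finally have "b 2 \<le> 1 - exp (- (s * l))" by (simp add: b_def r_def)
    also have "\<dots> \<le> s * q2"
    proof -
      have "(1 / s) * (1 - exp (- (s * l))) \<le> 1 - exp (- ((1 / s) * (s * l)))"
        using s by (intro one_minus_exp_scale) auto
      then show ?thesis using s by (simp add: q2l field_simps)
    qed
    finally show ?thesis by (simp add: s_def)
  qed
  have b2_lower: "q2 \<le> b 2"
  proof -
    have "p2 \<le> p2 / c" using c p2 by (simp add: field_simps)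
    then have "(1 - p2 / c) ^ m \<le> (1 - p2) ^ m" using y by (intro power_mono) linarith+
    also have "\<dots> \<le> exp (- l)" unfolding l_def
      using p2 p1 \<open>p2 \<le> p2 / c\<close> y by (intro one_minus_power_le_exp) linarith
    finally show ?thesis by (simp add: b_def r_def q2l)
  qed
  have b2x: "\<epsilon> / 4 * x \<le> b 2" using b2_lower q2x by linarith
  have b20: "0 < b 2" using b2_lower q2 by linarith
  have bk: "b k \<le> 2 * x * p ^ (k - 2)" if "3 \<le> k" for k
  proof -
    have "p ^ k \<le> p ^ 1" using p p1 that by (intro power_decreasing) auto
    then have "1 + real m * (- (2 * p ^ k)) \<le> (1 + - (2 * p ^ k)) ^ m"
      using p1 by (intro Bernoulli_inequality) auto
    then have "b k \<le> 2 * real m * p ^ k" using that by (simp add: b_def r_def)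
    also have "p ^ k = p ^ 2 * p ^ (k - 2)"
    proof -
      have "2 \<le> k" using that by simp
      then show ?thesis by (simp only: power_add[symmetric] le_add_diff_inverse)
    qed
    finally show ?thesis by (simp add: x_def mult_ac)
  qed
  have main: "(\<Sum>k=2..K. b k * (\<Prod>r=2..<k. real n / b 2 + real (r ^ 2 * d) / b 2 ^ r)) \<le> (1 + \<epsilon>) * q2"
  proof -
    have "b k * (\<Prod>r=2..<k. real n / b 2 + real (r ^ 2 * d) / b 2 ^ r)
        \<le> 2 * x * (\<Prod>r=2..<k. 36 * (4 / \<epsilon>) ^ 5 * (real n * p / x + d * p / x ^ r))" if k: "k \<in> {3..K}" for k
    proof -
      let ?h = "\<lambda>r. real n / b 2 + real (r ^ 2 * d) / b 2 ^ r"
      have h0: "0 \<le> ?h r" for r using b20 by (intro add_nonneg_nonneg divide_nonneg_nonneg) auto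
      have "b k * (\<Prod>r=2..<k. ?h r) \<le> 2 * x * p ^ (k - 2) * (\<Prod>r=2..<k. ?h r)"
        using bk[of k] k h0 by (intro mult_right_mono prod_nonneg) auto
      \<comment> \<open>The product has exactly \<open>k - 2\<close> factors, so each absorbs one
        \<open>p\<close>.\<close>
      also have "\<dots> = 2 * x * (\<Prod>r=2..<k. p * ?h r)"
        using k by (simp add: prod.distrib)
      also have "\<dots> \<le> 2 * x * (\<Prod>r=2..<k. 36 * (4 / \<epsilon>) ^ 5 * (real n * p / x + d * p / x ^ r))"
      proof (intro mult_left_mono prod_mono conjI)
        fix r assume r: "r \<in> {2..<k}"
        \<comment> \<open>As \<open>K \<le> 6\<close>, the index \<open>r\<close> is at most 5: the
          exponent 5 majorizes all powers of \<open>4 / \<epsilon>\<close>, and 36 is a crude bound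
          for \<open>r ^ 2\<close>.\<close>
        then have r5: "2 \<le> r" "r \<le> 5" using k K by auto
        show "0 \<le> p * ?h r" using p h0 by simp
        have e4: "1 \<le> 4 / \<epsilon>" using \<epsilon> by simp
        have 1: "real n / b 2 \<le> (4 / \<epsilon>) ^ 5 * (real n / x)"
        proof -
          have "real n / b 2 \<le> real n / (\<epsilon> / 4 * x)"
            using b2x \<epsilon> x0 b20 by (intro divide_left_mono) auto
          also have "\<dots> = (4 / \<epsilon>) ^ 1 * (real n / x)" by simp
          also have "\<dots> \<le> (4 / \<epsilon>) ^ 5 * (real n / x)"
            using e4 x0 by (intro mult_right_mono power_increasing) auto
          finally show ?thesis .
        qed
        have 2: "1 / b 2 ^ r \<le> (4 / \<epsilon>) ^ 5 * (1 / x ^ r)"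
        proof -
          have "1 / b 2 ^ r \<le> 1 / (\<epsilon> / 4 * x) ^ r"
            using b2x \<epsilon> x0 b20 by (intro divide_left_mono power_mono) auto
          also have "\<dots> = (4 / \<epsilon>) ^ r * (1 / x ^ r)" by (simp add: field_simps)
          also have "\<dots> \<le> (4 / \<epsilon>) ^ 5 * (1 / x ^ r)"
            using e4 x0 r5 by (intro mult_right_mono power_increasing) auto
          finally show ?thesis .
        qed
        have "real (r ^ 2) \<le> 36" using r5 power_mono[of "real r" 6 2] by simp
        then have "real (r ^ 2 * d) / b 2 ^ r \<le> 36 * (d * ((4 / \<epsilon>) ^ 5 * (1 / x ^ r)))"
          using mult_mono[OF \<open>real (r ^ 2) \<le> 36\<close> mult_left_mono[OF 2, of "real d"]] b20 by simp
        moreover have "real n / b 2 \<le> 36 * ((4 / \<epsilon>) ^ 5 * (real n / x))"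
        proof -
          have "0 \<le> (4 / \<epsilon>) ^ 5 * (real n / x)" using x0 \<epsilon> by simp
          then show ?thesis using 1 by linarith
        qed
        ultimately have "?h r \<le> 36 * (4 / \<epsilon>) ^ 5 * (real n / x + d / x ^ r)"
          by (simp add: algebra_simps)
        then have "p * ?h r \<le> p * (36 * (4 / \<epsilon>) ^ 5 * (real n / x + d / x ^ r))"
          using p by (intro mult_left_mono) auto
        also have "\<dots> = 36 * (4 / \<epsilon>) ^ 5 * (real n * p / x + d * p / x ^ r)"
          by (simp add: algebra_simps)
        finally show "p * ?h r \<le> 36 * (4 / \<epsilon>) ^ 5 * (real n * p / x + d * p / x ^ r)" .
      qed (use x0 in auto)
      finally show ?thesis .
    qed
    then have "(\<Sum>k=3..K. b k * (\<Prod>r=2..<k. real n / b 2 + real (r ^ 2 * d) / b 2 ^ r))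
        \<le> 2 * x * (\<Sum>k=3..K. \<Prod>r=2..<k. 36 * (4 / \<epsilon>) ^ 5 * (real n * p / x + d * p / x ^ r))"
      unfolding sum_distrib_left by (rule sum_mono)
    \<comment> \<open>The budget \<epsilon>^2/16 is chosen so that the result is \<epsilon>/2 times
      the lower bound \<epsilon> x/4 for \<open>q2\<close>.\<close>
    also have "\<dots> \<le> 2 * x * (\<epsilon> ^ 2 / 16)"
      using S[OF x] x0 by (intro mult_left_mono) auto
    also have "\<dots> = \<epsilon> / 2 * (\<epsilon> / 4 * x)" by (simp add: power2_eq_square)
    also have "\<dots> \<le> \<epsilon> / 2 * q2" using q2x \<epsilon> by (intro mult_left_mono) auto
    finally have *: "(\<Sum>k=3..K. b k * (\<Prod>r=2..<k. real n / b 2 + real (r ^ 2 * d) / b 2 ^ r)) \<le> \<epsilon> / 2 * q2" .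
    have "(\<Sum>k=2..K. b k * (\<Prod>r=2..<k. real n / b 2 + real (r ^ 2 * d) / b 2 ^ r))
        = b 2 + (\<Sum>k=3..K. b k * (\<Prod>r=2..<k. real n / b 2 + real (r ^ 2 * d) / b 2 ^ r))"
      using K by (simp add: sum.atLeast_Suc_atMost numeral_3_eq_3)
    then show ?thesis using * b2_upper by (simp add: algebra_simps)
  qed
  have "rig_prob n m p P \<le> gnp_prob n ((1 + \<epsilon>) * q2) P
      + real n ^ 2 * (real (n choose Suc d) * ((1 + \<epsilon>) * q2) ^ (2 * Suc d)) + m * (real n * p) ^ Suc K"
  proof (rule rig_le_gnp[where c = c and r = r, folded b_def])
    have "1 - (real n * p) ^ 2 \<le> 1 - bern (\<lambda>_. p) {0..<n} (\<lambda>V. of_bool (2 \<le> card V))"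
      using prob_card_ge[of p n 2] p p1 by simp
    also have "\<dots> = bern (\<lambda>_. p) {0..<n} (\<lambda>V. 1 - of_bool (2 \<le> card V))"
      by (simp add: bern_diff)
    also have "\<dots> = bern (\<lambda>_. p) {0..<n} (\<lambda>V. of_bool (card V \<le> 1))"
      by (rule bern_cong) auto
    finally show "c \<le> bern (\<lambda>_. p) {0..<n} (\<lambda>V. of_bool (card V \<le> 1))" by (simp add: c_def)
  next
    fix k assume k: "2 \<le> k" "k \<le> K"
    show "p ^ k * (1 - p) ^ (n - k) \<le> r k * c \<and> r k \<le> 1"
    proof (cases "k = 2")
      case True
      then show ?thesis using c y by (auto simp: r_def p2_def)
    next
      case False
      have "p ^ k \<le> p ^ 1" using p p1 k by (intro power_decreasing) auto
      moreover have "p ^ k * (1 - p) ^ (n - k) \<le> p ^ k * 1"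
        using p p1 by (intro mult_left_mono power_le_one) auto
      moreover have "p ^ k * (1 / 2) \<le> p ^ k * c" using c p by (intro mult_left_mono) auto
      ultimately show ?thesis using False p1 by (simp add: r_def)
    qed
  next
    show "(1 + \<epsilon>) * q2 \<le> 1" using q2 by (simp add: mult.commute)
  qed (use p p1 c K \<open>0 < m\<close> main[unfolded b_def] mono in auto)
  moreover have "real (n choose Suc d) * ((1 + \<epsilon>) * q2) ^ (2 * Suc d) \<le> (4 * real n * x ^ 2) ^ Suc d / fact (Suc d)"
  proof -
    have "real ((n choose Suc d) * fact (Suc d)) \<le> real (n ^ Suc d)"
      using binomial_fact_pow[of n "Suc d"] by (simp only: of_nat_le_iff)
    then have "real (n choose Suc d) \<le> real n ^ Suc d / fact (Suc d)"
      by (simp add: field_simps del: fact_Suc)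
    moreover have "((1 + \<epsilon>) * q2) ^ (2 * Suc d) \<le> (2 * x) ^ (2 * Suc d)"
      using \<epsilon> q2 by (intro power_mono mult_mono) auto
    ultimately have "real (n choose Suc d) * ((1 + \<epsilon>) * q2) ^ (2 * Suc d) \<le> real n ^ Suc d / fact (Suc d) * (2 * x) ^ (2 * Suc d)"
      using \<epsilon> q2 by (intro mult_mono) auto
    also have "\<dots> = (4 * real n * x ^ 2) ^ Suc d / fact (Suc d)"
      unfolding power_mult by (simp add: power_mult_distrib del: fact_Suc power_Suc)
    finally show ?thesis .
  qed
  then have "real n ^ 2 * (real (n choose Suc d) * ((1 + \<epsilon>) * q2) ^ (2 * Suc d)) \<le> real n ^ 2 * ((4 * real n * x ^ 2) ^ Suc d / fact (Suc d))"
    by (intro mult_left_mono) auto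
  ultimately show ?thesis using E[OF x] unfolding q2_def by linarith
qed

subsection \<open>Asymptotics\<close>

text \<open>A power of \<open>x\<close> is extremal at an end of the range, at which one depending
  on the sign of \<open>e\<close>. Requiring both end exponents below \<open>E\<close> spares later
  case distinctions.\<close>

lemma powr_le_of_bounds:
  fixes x :: real
  assumes "1 \<le> n" "n powr (- s) \<le> x" "x \<le> n powr t" "t * e \<le> E" "- s * e \<le> E"
  shows "x powr e \<le> n powr E"
proof (cases "0 \<le> e")
  case True
  have "0 \<le> n powr (- s)" by simp
  then have "x powr e \<le> (n powr t) powr e"
    using True assms by (intro powr_mono2) linarith+
  also have "\<dots> = n powr (t * e)" by (simp add: powr_powr)
  also have "\<dots> \<le> n powr E" using assms by (intro powr_mono) auto
  finally show ?thesis .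
next
  case False
  have "x powr e \<le> (n powr (- s)) powr e"
    using False assms by (intro powr_mono2') auto
  also have "\<dots> = n powr (- s * e)" by (simp add: powr_powr)
  also have "\<dots> \<le> n powr E" using assms by (intro powr_mono) auto
  finally show ?thesis .
qed

text \<open>p^2 = x/m, and m is at least n^3.\<close>

lemma object_prob_le:
  fixes p x :: real and n m :: nat
  assumes "0 < n" "n ^ 3 \<le> m" "0 < p"
  defines "x \<equiv> real m * p ^ 2"
  shows "p \<le> x powr (1/2) * real n powr (- 3/2)"
proof -
  have m: "0 < m" using assms(1,2) by (cases "m = 0") auto
  have x: "0 < x" using assms m by simp
  have "real n ^ 3 \<le> m" using assms(2) by (simp only: of_nat_le_iff flip: of_nat_power)
  then have "p ^ 2 * real n ^ 3 \<le> x" unfolding x_def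
    using mult_left_mono[of "real n ^ 3" m "p ^ 2"] by (simp add: mult.commute)
  then have "p ^ 2 \<le> x / real n ^ 3" using assms(1) by (simp add: field_simps)
  also have "\<dots> = (x powr (1/2) * real n powr (- 3/2)) ^ 2"
  proof -
    have "(x powr (1/2)) ^ 2 = x" using x by (simp add: powr_half_sqrt)
    moreover have "(real n powr (- 3/2)) ^ 2 = real n powr (- 3)"
      using assms(1) by (subst powr_power) auto
    moreover have "real n powr (- 3) = 1 / real n ^ 3"
      using assms(1) by (simp add: powr_minus divide_inverse)
    ultimately show ?thesis unfolding power_mult_distrib by simp
  qed
  finally show ?thesis by (rule power2_le_imp_le) auto
qed

text \<open>Bounds the expected number of objects with at least \<open>j + 2\<close> choosers. Two
  factors \<open>real n * p\<close> combine with \<open>m\<close> to x n^2, and each of the other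
  \<open>j\<close> is at most n^((t-1)/2).\<close>

lemma large_objects_bound:
  fixes p x :: real and n m :: nat
  assumes "0 < n" "n ^ 3 \<le> m" "0 < p"
  defines "x \<equiv> real m * p ^ 2"
  assumes "x \<le> real n powr t"
  shows "m * (real n * p) ^ (j + 2) \<le> real n powr (t + 2 + real j * ((t - 1) / 2))"
proof -
  have m: "0 < m" using assms(1,2) by (cases "m = 0") auto
  have x: "0 < x" using assms m by simp
  have "real n * p \<le> real n powr 1 * (x powr (1/2) * real n powr (- 3/2))"
    using object_prob_le[OF assms(1-3)] assms by (simp add: x_def mult_left_mono)
  also have "x powr (1/2) \<le> (real n powr t) powr (1/2)"
    using x assms by (intro powr_mono2) auto
  also have "real n powr 1 * ((real n powr t) powr (1/2) * real n powr (- 3/2)) = real n powr ((t - 1) / 2)"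
    using assms(1) by (simp add: powr_powr powr_mult_base field_simps flip: powr_add)
  finally have "real n * p \<le> real n powr ((t - 1) / 2)" by (simp add: mult_left_mono mult_right_mono)
  then have "(real n * p) ^ j \<le> (real n powr ((t - 1) / 2)) ^ j"
    using assms by (intro power_mono) auto
  also have "\<dots> = real n powr (real j * ((t - 1) / 2))"
    using assms(1) by (subst powr_power) auto
  finally have np: "(real n * p) ^ j \<le> real n powr (real j * ((t - 1) / 2))" .
  have "m * (real n * p) ^ (j + 2) = x * real n ^ 2 * (real n * p) ^ j"
    by (simp add: x_def power_add power_mult_distrib power2_eq_square mult_ac)
  also have "\<dots> \<le> real n powr t * real n ^ 2 * real n powr (real j * ((t - 1) / 2))"
    using np assms x by (intro mult_mono) auto
  also have "real n ^ 2 = real n powr 2" using assms by (simp add: powr_numeral)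
  finally show ?thesis by (simp add: powr_add)
qed

text \<open>With z = 4 n x^2, the term z^D/D! is e^(-2D) times (e^2 z)^D/D!, which is at most
  e^(-2D) exp(9 z) because e^2 is at most 9. The 36 is 9 times 4.\<close>

lemma codegree_tail:
  fixes x y :: real
  assumes "36 * n * x ^ 2 + y \<le> D" "0 \<le> y"
  shows "(4 * real n * x ^ 2) ^ D / fact D \<le> exp (- y)"
proof -
  define z where "z = 4 * real n * x ^ 2"
  have z: "0 \<le> z" by (simp add: z_def)
  have e2: "exp 2 \<le> (9 :: real)"
  proof -
    have "exp 1 ^ 2 \<le> (3 :: real) ^ 2" using exp_le by (intro power_mono) auto
    then show ?thesis by (simp flip: exp_of_nat_mult)
  qed
  have "(exp 2 * z) ^ D / fact D \<le> exp (exp 2 * z)" using z by (intro power_div_fact_le_exp) auto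
  also have "\<dots> \<le> exp (9 * z)" using e2 z by (simp add: mult_right_mono)
  also have "\<dots> \<le> exp (real D - y)" using assms by (simp add: z_def)
  finally have "exp 2 ^ D * (z ^ D / fact D) \<le> exp (real D - y)" by (simp add: power_mult_distrib)
  then have "z ^ D / fact D \<le> exp (real D - y) / exp 2 ^ D" by (simp add: field_simps)
  also have "\<dots> = exp (- y - real D)"
    by (simp add: exp_of_nat_mult[symmetric] exp_diff[symmetric])
  also have "\<dots> \<le> exp (- y)" by simp
  finally show ?thesis by (simp add: z_def)
qed

text \<open>The cost is bounded by three monomials in \<open>x\<close> and \<open>n\<close>:
  x^(-1/2) n^(-1/2), 36 times x^(5/2-r) n^(-1/2), and x^(1/2-r) n^(-29/20). The six conditions on
  \<open>\<tau>\<close> are their exponents at the two ends of the range of \<open>x\<close>; 38 is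
  1 + 36 + 1.\<close>

lemma extension_cost_bound:
  fixes p x :: real and n m d r :: nat
  assumes "0 < n" "n ^ 3 \<le> m" "0 < p"
  defines "x \<equiv> real m * p ^ 2"
  assumes d: "real d \<le> 36 * n * x ^ 2 + real n powr (1/20)"
    and x: "real n powr (- s) \<le> x" "x \<le> real n powr (1/10)"
    and \<tau>: "s / 2 - 1/2 \<le> \<tau>" "- 1/20 - 1/2 \<le> \<tau>"
      "(5/2 - r) / 10 - 1/2 \<le> \<tau>" "s * (r - 5/2) - 1/2 \<le> \<tau>"
      "(1/2 - r) / 10 - 29/20 \<le> \<tau>" "s * (r - 1/2) - 29/20 \<le> \<tau>"
  shows "real n * p / x + d * p / x ^ r \<le> 38 * real n powr \<tau>"
proof -
  have m: "0 < m" using assms(1,2) by (cases "m = 0") auto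
  have x0: "0 < x" using assms m by simp
  have n1: "1 \<le> real n" using assms by simp
  have p: "p \<le> x powr (1/2) * real n powr (- 3/2)"
    unfolding x_def by (rule object_prob_le[OF assms(1-3)])
  have *: "x powr e * real n powr f \<le> real n powr \<tau>" if "e / 10 + f \<le> \<tau>" "- s * e + f \<le> \<tau>" for e f
  proof -
    have "x powr e \<le> real n powr (\<tau> - f)"
      by (rule powr_le_of_bounds[OF n1 x]) (use that in auto)
    then have "x powr e * real n powr f \<le> real n powr (\<tau> - f) * real n powr f" by (intro mult_right_mono) auto
    then show ?thesis by (simp flip: powr_add)
  qed
  have "real n * p / x \<le> real n * (x powr (1/2) * real n powr (- 3/2)) / x"
    using p x0 by (intro divide_right_mono mult_left_mono) auto
  also have "\<dots> = x powr (1/2 - 1) * real n powr (1 - 3/2)"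
    unfolding powr_diff using x0 n1 by (simp add: powr_minus field_simps)
  also have "\<dots> \<le> real n powr \<tau>" by (rule *) (use \<tau> in auto)
  finally have 1: "real n * p / x \<le> real n powr \<tau>" .
  have "d * p / x ^ r \<le> (36 * n * x ^ 2 + real n powr (1/20)) * (x powr (1/2) * real n powr (- 3/2)) / x ^ r"
    using p d x0 assms(3) by (intro divide_right_mono mult_mono) auto
  also have "\<dots> = 36 * (x powr (5/2 - r) * real n powr (- 1/2)) + x powr (1/2 - r) * real n powr (- 29/20)"
  proof -
    have a: "real n * x ^ 2 * (x powr (1/2) * real n powr (- 3/2)) / x ^ r = x powr (5/2 - r) * real n powr (- 1/2)"
    proof -
      have "real n * x ^ 2 * (x powr (1/2) * real n powr (- 3/2)) / x ^ r
        = (x powr 2 * x powr (1/2) / x powr r) * (real n powr 1 * real n powr (- 3/2))"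
        using x0 n1 by (simp add: powr_realpow powr_numeral)
      then show ?thesis unfolding powr_add[symmetric] powr_diff[symmetric] by simp
    qed
    have b: "real n powr (1/20) * (x powr (1/2) * real n powr (- 3/2)) / x ^ r = x powr (1/2 - r) * real n powr (- 29/20)"
    proof -
      have "real n powr (1/20) * (x powr (1/2) * real n powr (- 3/2)) / x ^ r
        = (x powr (1/2) / x powr r) * (real n powr (1/20) * real n powr (- 3/2))"
        using x0 by (simp add: powr_realpow)
      then show ?thesis by (simp flip: powr_add powr_diff)
    qed
    show ?thesis unfolding a[symmetric] b[symmetric] by (simp add: algebra_simps add_divide_distrib)
  qed
  also have "\<dots> \<le> 36 * real n powr \<tau> + real n powr \<tau>"
    by (intro add_mono mult_left_mono *) (use \<tau> in \<open>auto simp: algebra_simps\<close>)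
  finally show ?thesis using 1 by linarith
qed

lemma prod_2_3: "prod f {2..<3} = (f 2 :: real)"
  and prod_2_4: "prod f {2..<4} = (f 2 * f 3 :: real)"
  and prod_2_5: "prod f {2..<5} = (f 2 * f 3 * f 4 :: real)"
  and prod_2_6: "prod f {2..<6} = (f 2 * f 3 * f 4 * f 5 :: real)"
  for f :: "nat \<Rightarrow> real"
  by (simp_all add: eval_nat_numeral prod.atLeastLessThan_Suc)

lemma sum_3_6: "sum f {3..3} = (f 3 :: real)" "sum f {3..4} = (f 3 + f 4 :: real)"
    "sum f {3..6} = (f 3 + f 4 + f 5 + f 6 :: real)"
  for f :: "nat \<Rightarrow> real"
  by (simp_all add: eval_nat_numeral)

lemma prod_le_power2:
  fixes a b w :: real
  assumes "0 \<le> a" "a \<le> w" "0 \<le> b" "b \<le> w"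
  shows "a * b \<le> w ^ 2"
  using assms mult_mono[of a w b w] by (simp add: power2_eq_square)

text \<open>The three ranges of \<open>x = m p\<^sup>2\<close> correspond to the largest number \<open>K\<close> of vertices sharing an
  object: for \<open>m = n\<^sup>3\<close>, objects chosen by \<open>k\<close> vertices appear when \<open>n\<^sup>k x\<^bsup>k/2\<^esup> m\<^bsup>1-k/2\<^esup>\<close> is of order \<open>1\<close>.
  Cliques of a size that does not occur must be left out, since their bound
  in \<open>rig_upper\<close> would be too weak.\<close>
lemma eventually_rig_upper:
  fixes p :: "nat \<Rightarrow> real" and m :: "nat \<Rightarrow> nat" and \<epsilon> :: real
  assumes \<epsilon>: "0 < \<epsilon>" "\<epsilon> \<le> 1"
    and m: "\<And>n. n ^ 3 \<le> m n"
    and p: "eventually (\<lambda>n. 0 < p n) at_top"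
    and np: "(\<lambda>n. real n * p n) \<longlonglongrightarrow> 0"
    and \<kappa>: "(\<lambda>n. 1 / (root 3 (m n) ^ 2 * p n)) \<longlonglongrightarrow> 0"
    and mono: "\<And>n G G'. G \<in> A n \<Longrightarrow> G \<subseteq> G' \<Longrightarrow> G' \<subseteq> all_edges n \<Longrightarrow> G' \<in> A n"
  shows "eventually (\<lambda>n. rig_prob n (m n) (p n) (A n)
    \<le> gnp_prob n ((1 + \<epsilon>) * edge_prob n (m n) (p n)) (A n) + \<epsilon>) at_top"
proof -
  define C where "C = 36 * (4 / \<epsilon>) ^ 5"
  have C: "0 < C" using \<epsilon> by (simp add: C_def)
  \<comment> \<open>The cube of \<open>k n\<close> is m p^3 / (m p^2)^3, the cost of a triangle from
    one object relative to three pairs.\<close>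
  define k where "k n = 1 / (root 3 (m n) ^ 2 * p n)" for n
  have "(\<lambda>n. (real n * p n) ^ 2) \<longlonglongrightarrow> 0" using tendsto_power[OF np, of 2] by simp
  then have ev1: "eventually (\<lambda>n. (real n * p n) ^ 2 < \<epsilon> / 16) at_top"
    by (rule order_tendstoD) (use \<epsilon> in auto)
  have ev2: "eventually (\<lambda>n. real n * p n < 1 / 2) at_top"
    by (rule order_tendstoD(2)[OF np]) auto
  have "(\<lambda>n. C * (k n + 30 * k n ^ 3)) \<longlonglongrightarrow> C * (0 + 30 * 0 ^ 3)"
    by (intro tendsto_intros \<kappa>[folded k_def])
  then have ev3: "eventually (\<lambda>n. C * (k n + 30 * k n ^ 3) < \<epsilon> ^ 2 / 16) at_top"
    by (rule order_tendstoD) (use \<epsilon> in auto)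
  have "(\<lambda>n. real n ^ 2 * ((4 * real n powr (- 1/10)) ^ 31 / fact 31) + real n powr (- 1/10)) \<longlonglongrightarrow> 0"
    by real_asymp
  then have ev4: "eventually (\<lambda>n. real n ^ 2 * ((4 * real n powr (- 1/10)) ^ 31 / fact 31) + real n powr (- 1/10) < \<epsilon>) at_top"
    by (rule order_tendstoD) (use \<epsilon> in auto)
  have "(\<lambda>n. real n ^ 2 * exp (- (real n powr (1/20))) + real n powr (- 1/8)) \<longlonglongrightarrow> 0"
    by real_asymp
  then have ev5: "eventually (\<lambda>n. real n ^ 2 * exp (- (real n powr (1/20))) + real n powr (- 1/8) < \<epsilon>) at_top"
    by (rule order_tendstoD) (use \<epsilon> in auto)
  have "(\<lambda>n. real n powr (- 3/40)) \<longlonglongrightarrow> 0" by real_asymp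
  then have "(\<lambda>n. C * (38 * real n powr (- 3/40))) \<longlonglongrightarrow> C * (38 * 0)"
    by (intro tendsto_intros)
  then have ev6: "eventually (\<lambda>n. C * (38 * real n powr (- 3/40)) < \<epsilon> ^ 2 / 64) at_top"
    by (rule order_tendstoD) (use \<epsilon> in auto)
  have "filterlim (\<lambda>n. real n powr (1/10)) at_top at_top" by real_asymp
  then have ev7: "eventually (\<lambda>n. 4 / \<epsilon> \<le> real n powr (1/10)) at_top"
    by (simp add: filterlim_at_top)
  show ?thesis
    using p ev1 ev2 ev3 ev4 ev5 ev6 ev7 eventually_ge_at_top[of 2]
  proof eventually_elim
    case (elim n)
    define M P x where "M = m n" and "P = p n" and "x = real M * P ^ 2"
    have n0: "0 < n" "1 \<le> real n" using elim by auto
    have nM: "n ^ 3 \<le> M" using m[of n] by (simp add: M_def)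
    have M0: "0 < M" using n0(1) nM by (cases "M = 0") auto
    have P0: "0 < P" using elim by (simp add: P_def)
    have x0: "0 < x" using P0 M0 by (simp add: x_def)
    let ?G = "\<lambda>d r. real n * P / x + real d * P / x ^ r"
    have G0: "0 \<le> ?G d r" for d r using P0 x0 by simp
    have goal: "rig_prob n M P (A n) \<le> gnp_prob n ((1 + \<epsilon>) * edge_prob n M P) (A n) + \<epsilon>"
      if K: "2 \<le> K" "K \<le> 6"
        and S: "x \<le> 4 / \<epsilon> \<Longrightarrow> (\<Sum>k=3..K. \<Prod>r=2..<k. C * ?G d r) \<le> \<epsilon> ^ 2 / 16"
        and E: "x \<le> 4 / \<epsilon> \<Longrightarrow> real n ^ 2 * ((4 * real n * x ^ 2) ^ Suc d / fact (Suc d)) + M * (real n * P) ^ Suc K \<le> \<epsilon>" for K d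
      by (rule rig_upper[OF \<epsilon> P0 _ _ _ M0 K mono S[unfolded C_def x_def] E[unfolded x_def]])
         (use elim in \<open>auto simp: P_def\<close>)
    \<comment> \<open>The threshold follows the codegree bound of \<open>codegree_tail\<close>. The
      extra n^(1/20) makes the tail beat the factor n^2 even where n x^2 is small.\<close>
    define d where "d = nat \<lfloor>36 * n * x ^ 2 + real n powr (1/20)\<rfloor>"
    have d0: "0 \<le> 36 * n * x ^ 2 + real n powr (1/20)" by simp
    have d: "real d \<le> 36 * n * x ^ 2 + real n powr (1/20)" "36 * n * x ^ 2 + real n powr (1/20) \<le> real (Suc d)"
      unfolding d_def using d0 by linarith+
    define y where "y = C * (38 * real n powr (- 3/40))"
    have y: "0 \<le> y" "y \<le> \<epsilon> ^ 2 / 64" using C elim by (auto simp: y_def)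
    have "\<epsilon> ^ 2 \<le> 1" using \<epsilon> by (intro power_le_one) auto
    then have y1: "y \<le> 1" using y by linarith
    have y2: "y ^ 2 \<le> y" "y ^ 3 \<le> y" "y ^ 4 \<le> y"
      using power_decreasing[of 1 2 y] power_decreasing[of 1 3 y] power_decreasing[of 1 4 y] y y1 by simp_all
    have tail: "(4 * real n * x ^ 2) ^ Suc d / fact (Suc d) \<le> exp (- (real n powr (1/20)))"
      by (rule codegree_tail) (use d in auto)
    have tail': "real n ^ 2 * ((4 * real n * x ^ 2) ^ Suc d / fact (Suc d)) \<le> real n ^ 2 * exp (- (real n powr (1/20)))"
      by (intro mult_left_mono tail) auto
    have n18: "real n powr e \<le> real n powr (- 1/8)" if "e \<le> - 1/8" for e
      using n0 that by (intro powr_mono) auto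
    consider "x \<le> real n powr (- 11/20)" | "real n powr (- 11/20) < x" "x \<le> real n powr (- 1/4)" | "real n powr (- 1/4) < x"
      by linarith
    then have "rig_prob n M P (A n) \<le> gnp_prob n ((1 + \<epsilon>) * edge_prob n M P) (A n) + \<epsilon>"
    proof cases
      case 1
      show ?thesis
      \<comment> \<open>Only \<open>k n\<close> tending to 0 without a rate is known here, so the
        threshold must be constant. Since n x^2 is at most n^(-1/10), the tail with 31 factors is of
        order n^(2 - 31/10).\<close>
      proof (rule goal[of 3 30])
        define \<rho> where "\<rho> = root 3 M"
        have \<rho>3: "real M = \<rho> ^ 3" by (simp add: \<rho>_def)
        have \<rho>0: "0 < \<rho>" using M0 by (simp add: \<rho>_def)
        have "real n ^ 3 \<le> real M" using nM by (simp only: of_nat_le_iff flip: of_nat_power)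
        then have \<rho>n: "real n \<le> \<rho>" using \<rho>0 unfolding \<rho>3 by (simp add: power_mono_iff)
        have kn: "k n = 1 / (\<rho> ^ 2 * P)" by (simp add: k_def \<rho>_def M_def P_def)
        have "real n * P / x = (real n / \<rho>) * k n"
          using P0 \<rho>0 unfolding x_def \<rho>3 kn by (simp add: field_simps eval_nat_numeral)
        also have "\<dots> \<le> 1 * k n"
          using \<rho>n \<rho>0 P0 by (intro mult_right_mono) (auto simp: kn)
        finally have "real n * P / x \<le> k n" by simp
        moreover have "real 30 * P / x ^ 2 = 30 * k n ^ 3"
          using P0 \<rho>0 unfolding x_def \<rho>3 kn by (simp add: field_simps eval_nat_numeral)
        ultimately have "C * ?G 30 2 \<le> C * (k n + 30 * k n ^ 3)"
          using C by (intro mult_left_mono) auto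
        then show "(\<Sum>k=3..3. \<Prod>r=2..<k. C * ?G 30 r) \<le> \<epsilon> ^ 2 / 16"
          unfolding sum_3_6 prod_2_3 using elim by linarith
      next
        have "x ^ 2 \<le> (real n powr (- 11/20)) ^ 2" using 1 x0 by (intro power_mono) auto
        also have "\<dots> = real n powr (- 11/10)" using n0 by (subst powr_power) auto
        finally have "real n * x ^ 2 \<le> real n powr 1 * real n powr (- 11/10)"
          by (intro mult_mono) auto
        then have le: "4 * real n * x ^ 2 \<le> 4 * real n powr (- 1/10)" using n0 by (simp add: powr_mult_base)
        have suc: "Suc 30 = 31" by simp
        have "real n ^ 2 * ((4 * real n * x ^ 2) ^ Suc 30 / fact (Suc 30)) \<le> real n ^ 2 * ((4 * real n powr (- 1/10)) ^ 31 / fact 31)"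
          unfolding suc by (rule mult_left_mono, rule divide_right_mono, rule power_mono[OF le]) simp_all
        moreover have "M * (real n * P) ^ Suc 3 \<le> real n powr (- 1/10)"
          using large_objects_bound[OF n0(1) nM P0, of "- 11/20" 2] 1 by (simp add: x_def numeral_eq_Suc)
        ultimately show "real n ^ 2 * ((4 * real n * x ^ 2) ^ Suc 30 / fact (Suc 30)) + M * (real n * P) ^ Suc 3 \<le> \<epsilon>"
          using elim by linarith
      qed auto
    next
      case 2
      \<comment> \<open>The exponent -3/40 is attained at \<open>r = 3\<close> and x = n^(-11/20),
        by the part of the cost coming from the n^(1/20) in \<open>d\<close>.\<close>
      have G: "C * ?G d r \<le> y" if "r \<in> {2, 3}" for r
      proof -
        have "real n powr (- 1/4) \<le> real n powr (1/10)" using n0 by (intro powr_mono) auto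
        then have "?G d r \<le> 38 * real n powr (- 3/40)"
          unfolding x_def
          by (intro extension_cost_bound[where s = "11/20", OF n0(1) nM P0 d(1)[unfolded x_def]])
             (use 2 that in \<open>auto simp: x_def\<close>)
        then show ?thesis using C by (simp add: y_def)
      qed
      show ?thesis
      proof (rule goal[of 4 d])
        have G2: "C * ?G d 2 \<le> y" by (rule G) simp
        have "C * ?G d 2 * (C * ?G d 3) \<le> y ^ 2"
          using G[of 2] G[of 3] G0 C by (intro prod_le_power2 mult_nonneg_nonneg) auto
        then show "(\<Sum>k=3..4. \<Prod>r=2..<k. C * ?G d r) \<le> \<epsilon> ^ 2 / 16"
          unfolding sum_3_6 prod_2_3 prod_2_4 using G2 y y2 by linarith
      next
        have "M * (real n * P) ^ Suc 4 \<le> real n powr (- 1/8)"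
          using large_objects_bound[OF n0(1) nM P0, of "- 1/4" 3] 2 by (simp add: x_def numeral_eq_Suc)
        then show "real n ^ 2 * ((4 * real n * x ^ 2) ^ Suc d / fact (Suc d)) + M * (real n * P) ^ Suc 4 \<le> \<epsilon>"
          using tail' elim by linarith
      qed auto
    next
      case 3
      have G: "C * ?G d r \<le> C * (38 * real n powr \<tau>)"
        if "x \<le> 4 / \<epsilon>" "(r, \<tau>) \<in> {(2, - 3/8), (3, - 3/8), (4, - 1/8), (5, 1/8)}" for r \<tau>
      proof -
        have "x \<le> real n powr (1/10)" using that elim by linarith
        then have "?G d r \<le> 38 * real n powr \<tau>"
          unfolding x_def
          by (intro extension_cost_bound[where s = "1/4", OF n0(1) nM P0 d(1)[unfolded x_def]])
             (use 3 that(2) in \<open>auto simp: x_def\<close>)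
        then show ?thesis using C by (intro mult_left_mono) auto
      qed
      have Gy: "C * (38 * real n powr \<tau>) \<le> y" if "\<tau> \<le> - 3/40" for \<tau>
        unfolding y_def using C n0 that by (intro mult_left_mono powr_mono) auto
      show ?thesis
      proof (rule goal[of 6 d])
        assume x: "x \<le> 4 / \<epsilon>"
        define g where "g r = C * ?G d r" for r
        have g0: "0 \<le> g r" for r unfolding g_def using G0 C by (intro mult_nonneg_nonneg) auto
        have g: "g 2 \<le> y" "g 3 \<le> y" "g 4 \<le> y"
          using G[OF x, of 2 "- 3/8"] G[OF x, of 3 "- 3/8"] G[OF x, of 4 "- 1/8"] Gy[of "- 3/8"] Gy[of "- 1/8"]
          by (auto simp: g_def intro: order_trans)
        \<comment> \<open>The factor at \<open>r = 5\<close> may grow like n^(1/8), but it occurs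
          only together with the one at \<open>r = 2\<close>. The exponents -3/8 and 1/8 add up to
          twice -1/8.\<close>
        have "g 2 * g 5 \<le> (C * (38 * real n powr (- 3/8))) * (C * (38 * real n powr (1/8)))"
          using G[OF x, of 2 "- 3/8"] G[OF x, of 5 "1/8"] C g0 by (intro mult_mono) (auto simp: g_def[symmetric])
        also have "\<dots> = (C * (38 * real n powr (- 1/8))) * (C * (38 * real n powr (- 1/8)))"
          by (simp flip: powr_add)
        also have "\<dots> \<le> y ^ 2" using Gy[of "- 1/8"] C by (intro prod_le_power2) auto
        finally have g25: "g 2 * g 5 \<le> y ^ 2" .
        have g23: "g 2 * g 3 \<le> y ^ 2" "g 3 * g 4 \<le> y ^ 2" using g g0 by (auto intro: prod_le_power2)
        have "g 2 * g 3 * g 4 \<le> y ^ 2 * y" using g g0 g23 y by (intro mult_mono) auto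
        moreover have "g 2 * g 5 * (g 3 * g 4) \<le> y ^ 2 * y ^ 2" using g0 g23 g25 y by (intro mult_mono) auto
        ultimately have "g 2 + g 2 * g 3 + g 2 * g 3 * g 4 + g 2 * g 3 * g 4 * g 5 \<le> y + y ^ 2 + y ^ 3 + y ^ 4"
          using g g23 by (simp add: eval_nat_numeral mult_ac)
        then show "(\<Sum>k=3..6. \<Prod>r=2..<k. C * ?G d r) \<le> \<epsilon> ^ 2 / 16"
          unfolding sum_3_6 prod_2_3 prod_2_4 prod_2_5 prod_2_6 g_def[symmetric]
          using y y2 by linarith
      next
        assume x: "x \<le> 4 / \<epsilon>"
        then have "x \<le> real n powr (1/10)" using elim by linarith
        then have "M * (real n * P) ^ Suc 6 \<le> real n powr (- 3/20)"
          using large_objects_bound[OF n0(1) nM P0, of "1/10" 5] by (simp add: x_def numeral_eq_Suc)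
        then show "real n ^ 2 * ((4 * real n * x ^ 2) ^ Suc d / fact (Suc d)) + M * (real n * P) ^ Suc 6 \<le> \<epsilon>"
          using tail' elim n18[of "- 3/20"] by linarith
      qed auto
    qed
    then show ?case by (simp add: M_def P_def)
  qed
qed

text \<open>Among the rates 1/(k+1) with k at most n for which \<open>Q\<close> holds at
  \<open>n\<close>, the smallest is taken. Each fixed rate is eventually admissible, so this tends
  to 0; \<open>Q\<close> need not be monotone in the rate. The inserted 0 keeps \<open>Max\<close>
  defined for the remaining \<open>n\<close>.\<close>

lemma diagonal_rate:
  fixes Q :: "real \<Rightarrow> nat \<Rightarrow> bool"
  assumes "\<And>\<epsilon>. 0 < \<epsilon> \<Longrightarrow> \<epsilon> \<le> 1 \<Longrightarrow> eventually (Q \<epsilon>) at_top"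
  obtains e where "e \<longlonglongrightarrow> 0" "eventually (\<lambda>n. Q (e n) n) at_top"
proof
  define S where "S n = {k. k \<le> n \<and> Q (1 / real (Suc k)) n}" for n
  define e where "e n = 1 / real (Suc (Max (insert 0 (S n))))" for n
  have fin: "finite (S n)" for n by (simp add: S_def)
  have ev: "eventually (\<lambda>n. k \<in> S n) at_top" for k
    unfolding S_def mem_Collect_eq
    by (intro eventually_conj eventually_ge_at_top assms) auto
  show "eventually (\<lambda>n. Q (e n) n) at_top"
    using ev[of 0]
  proof eventually_elim
    case (elim n)
    then have "Max (insert 0 (S n)) \<in> S n"
      using Max_in[OF fin, of n] by (auto simp: insert_absorb)
    then show ?case by (simp add: S_def e_def)
  qed
  show "e \<longlonglongrightarrow> 0"
  proof (rule order_tendstoI)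
    fix a :: real assume "a < 0"
    then show "eventually (\<lambda>n. a < e n) at_top"
      by (intro always_eventually allI) (auto simp: e_def intro: less_le_trans)
  next
    fix a :: real assume "0 < a"
    then obtain k where k: "1 / real (Suc k) < a" using nat_approx_posE by metis
    show "eventually (\<lambda>n. e n < a) at_top"
      using ev[of k]
    proof eventually_elim
      case (elim n)
      then have "k \<le> Max (insert 0 (S n))" using fin by simp
      then have "e n \<le> 1 / real (Suc k)" by (simp add: e_def frac_le)
      then show ?case using k by simp
    qed
  qed
qed

text \<open>Sandwich between two perturbed edge probabilities, with \<epsilon> = -1/n below and the
  diagonal sequence above.\<close>

lemma rig_limit_increasing:
  fixes p :: "nat \<Rightarrow> real" and m :: "nat \<Rightarrow> nat" and a :: real
  assumes p01: "\<And>n. 0 \<le> p n \<and> p n \<le> 1"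
    and m: "\<And>n. n ^ 3 \<le> m n"
    and p: "eventually (\<lambda>n. 0 < p n) at_top"
    and np: "(\<lambda>n. real n * p n) \<longlonglongrightarrow> 0"
    and \<kappa>: "(\<lambda>n. 1 / (root 3 (m n) ^ 2 * p n)) \<longlonglongrightarrow> 0"
    and mono: "\<And>n G G'. G \<in> A n \<Longrightarrow> G \<subseteq> G' \<Longrightarrow> G' \<subseteq> all_edges n \<Longrightarrow> G' \<in> A n"
    and lim: "\<And>\<epsilon>. \<epsilon> \<longlonglongrightarrow> 0 \<Longrightarrow> (\<lambda>n. gnp_prob n ((1 + \<epsilon> n) * edge_prob n (m n) (p n)) (A n)) \<longlonglongrightarrow> a"
  shows "(\<lambda>n. rig_prob n (m n) (p n) (A n)) \<longlonglongrightarrow> a"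
proof -
  obtain e where e: "e \<longlonglongrightarrow> 0" "eventually (\<lambda>n. rig_prob n (m n) (p n) (A n)
      \<le> gnp_prob n ((1 + e n) * edge_prob n (m n) (p n)) (A n) + e n) at_top"
    by (rule diagonal_rate[where Q = "\<lambda>\<epsilon> n. rig_prob n (m n) (p n) (A n)
      \<le> gnp_prob n ((1 + \<epsilon>) * edge_prob n (m n) (p n)) (A n) + \<epsilon>"])
       (auto intro: eventually_rig_upper[OF _ _ m p np \<kappa> mono])
  have inv: "(\<lambda>n. - (1 / real n)) \<longlonglongrightarrow> 0"
    using tendsto_minus[OF lim_1_over_n] by simp
  show ?thesis
  proof (rule tendsto_sandwich)
    show "eventually (\<lambda>n. gnp_prob n ((1 + - (1 / n)) * edge_prob n (m n) (p n)) (A n) \<le> rig_prob n (m n) (p n) (A n)) at_top"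
      using eventually_gt_at_top[of 0]
      by eventually_elim (rule rig_lower, use p01 m mono in auto)
    show "(\<lambda>n. gnp_prob n ((1 + e n) * edge_prob n (m n) (p n)) (A n) + e n) \<longlonglongrightarrow> a"
      using tendsto_add[OF lim[OF e(1)] e(1)] by simp
  qed (use e lim[OF inv] in auto)
qed

lemma gnp_prob_compl: "gnp_prob n q (Pow (all_edges n) - P) = 1 - gnp_prob n q P"
proof -
  have "gnp_prob n q (Pow (all_edges n) - P)
      = bern (\<lambda>_. max 0 (min 1 q)) (all_edges n) (\<lambda>E. 1 - of_bool (E \<in> P))"
    unfolding gnp_prob_eq_bern by (rule bern_cong) auto
  then show ?thesis by (simp add: bern_diff gnp_prob_eq_bern)
qed

lemma rig_prob_compl: "rig_prob n m p (Pow (all_edges n) - P) = 1 - rig_prob n m p P"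
proof -
  have "object_graph clique n m S \<subseteq> all_edges n" for S
    by (rule object_graph_subset) (rule clique_subset_all_edges)
  then have "rig_prob n m p (Pow (all_edges n) - P)
      = bern (\<lambda>_. p) ({0..<n} \<times> {0..<m}) (\<lambda>S. 1 - of_bool (object_graph clique n m S \<in> P))"
    unfolding rig_prob_eq_bern by (intro bern_cong) auto
  then show ?thesis by (simp add: bern_diff rig_prob_eq_bern)
qed

lemma num_objects_ge:
  assumes "3 \<le> \<alpha>"
  shows "n ^ 3 \<le> nat \<lfloor>real n powr \<alpha>\<rfloor>"
proof (cases "n = 0")
  case False
  then have "real n powr 3 \<le> real n powr \<alpha>" using assms by (intro powr_mono) auto
  then have "of_int (int (n ^ 3)) \<le> real n powr \<alpha>" using False by simp
  then have "int (n ^ 3) \<le> \<lfloor>real n powr \<alpha>\<rfloor>" by (simp only: le_floor_iff)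
  then show ?thesis by linarith
qed simp

theorem theorem2:
  fixes a \<alpha> :: real
    and m :: "nat \<Rightarrow> nat"
    and p :: "nat \<Rightarrow> real"
    and A :: "nat \<Rightarrow> nat set set set"
  assumes a: "0 \<le> a" "a \<le> 1"
    and alpha: "\<alpha> \<ge> 3"
    and m_def: "\<forall>n. m n = nat \<lfloor>real n powr \<alpha>\<rfloor>"
    and mono: "monotone_property A"
    and p_prob: "\<forall>n. 0 \<le> p n \<and> p n \<le> 1"
    and p_lower: "p \<in> \<Omega>(\<lambda>n. 1 / (real n * root 3 (real (m n))))"
    and p_upper: "p \<in> O(\<lambda>n. sqrt (ln (real n) / real (m n)))"
    and p_alpha3: "\<alpha> = 3 \<Longrightarrow> (\<lambda>n. 1 / (real n * root 3 (real (m n)))) \<in> o(p)"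
    and q2_lim: "(\<lambda>n. gnp_prob n (1 - exp (- (real (m n) * (p n)^2 * (1 - p n)^(n - 2)))) (A n))
                   \<longlonglongrightarrow> a"
    and q2_eps: "\<And>\<epsilon> :: nat \<Rightarrow> real. \<epsilon> \<longlonglongrightarrow> 0 \<Longrightarrow>
                   (\<lambda>n. gnp_prob n ((1 + \<epsilon> n) *
                      (1 - exp (- (real (m n) * (p n)^2 * (1 - p n)^(n - 2))))) (A n)) \<longlonglongrightarrow> a"
  shows "(\<lambda>n. rig_prob n (m n) (p n) (A n)) \<longlonglongrightarrow> a"
proof -
  have m3: "n ^ 3 \<le> m n" for n using num_objects_ge[OF alpha] m_def by simp
  have root_ge: "real n \<le> root 3 (m n)" for n
  proof -
    have "root 3 (real n ^ 3) \<le> root 3 (m n)"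
      using m3[of n] by (intro real_root_le_mono) (simp_all flip: of_nat_power)
    then show ?thesis by (simp add: real_root_power_cancel)
  qed
  obtain c where c: "0 < c" and ev_c: "eventually (\<lambda>n. c * norm (1 / (real n * root 3 (m n))) \<le> norm (p n)) at_top"
    using landau_omega.bigE[OF p_lower] by blast
  have lower: "eventually (\<lambda>n. 0 < n \<and> c / (real n * root 3 (m n)) \<le> p n) at_top"
    using ev_c eventually_gt_at_top[of 0]
  proof eventually_elim
    case (elim n)
    have "0 \<le> root 3 (m n)" by simp
    then show ?case using elim p_prob by (simp add: abs_mult)
  qed
  have root0: "0 < root 3 (m n)" if "0 < n" for n
    using root_ge[of n] that by linarith
  have p0: "eventually (\<lambda>n. 0 < p n) at_top"
    using lower
  proof eventually_elim
    case (elim n)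
    then have "0 < c / (real n * root 3 (m n))" using c root0 by simp
    then show ?case using elim by linarith
  qed
  \<comment> \<open>As m is at least n^3, the upper bound on \<open>p\<close> makes n p at most a
    constant times sqrt(ln n / n).\<close>
  have np: "(\<lambda>n. real n * p n) \<longlonglongrightarrow> 0"
  proof -
    obtain C where C: "0 < C" "eventually (\<lambda>n. norm (p n) \<le> C * norm (sqrt (ln (real n) / real (m n)))) at_top"
      using landau_o.bigE[OF p_upper] by blast
    have "(\<lambda>n. real n * sqrt (ln (real n) / real n ^ 3)) \<longlonglongrightarrow> 0" by real_asymp
    then have "(\<lambda>n. C * (real n * sqrt (ln (real n) / real n ^ 3))) \<longlonglongrightarrow> 0"
      by (rule tendsto_mult_right_zero)
    then show ?thesis
    proof (rule tendsto_sandwich[OF _ _ tendsto_const, rotated 2])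
      show "eventually (\<lambda>n. real n * p n \<le> C * (real n * sqrt (ln (real n) / real n ^ 3))) at_top"
        using C(2) eventually_gt_at_top[of 0]
      proof eventually_elim
        case (elim n)
        have le: "real n ^ 3 \<le> m n" using m3[of n] by (simp only: of_nat_le_iff flip: of_nat_power)
        have "0 < real n ^ 3" using elim by simp
        then have "0 < real (m n)" using le by linarith
        then have "sqrt (ln (real n) / real (m n)) \<le> sqrt (ln (real n) / real n ^ 3)"
          using elim le by (intro real_sqrt_le_mono divide_left_mono) auto
        then have "C * sqrt (ln (real n) / real (m n)) \<le> C * sqrt (ln (real n) / real n ^ 3)"
          using C(1) by (intro mult_left_mono) auto
        moreover have "p n \<le> C * sqrt (ln (real n) / real (m n))"
          using elim p_prob by simp
        ultimately have "p n \<le> C * sqrt (ln (real n) / real n ^ 3)" by linarith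
        then have "real n * p n \<le> real n * (C * sqrt (ln (real n) / real n ^ 3))"
          by (intro mult_left_mono) auto
        then show ?case by (simp only: mult_ac)
      qed
    qed (use p_prob in \<open>auto intro!: always_eventually\<close>)
  qed
  \<comment> \<open>Since n is at most m^(1/3), the extra assumption suffices directly for \<alpha>
    = 3. For \<alpha> > 3 the lower bound on \<open>p\<close> leaves n / m^(1/3), up to a constant,
    which tends to 0.\<close>
  have \<kappa>: "(\<lambda>n. 1 / (root 3 (m n) ^ 2 * p n)) \<longlonglongrightarrow> 0"
  proof (cases "\<alpha> = 3")
    case True
    have lim: "(\<lambda>n. 1 / (real n * root 3 (m n)) / p n) \<longlonglongrightarrow> 0"
      by (rule smalloD_tendsto[OF p_alpha3[OF True]])
    show ?thesis
    proof (rule tendsto_sandwich[OF _ _ tendsto_const lim])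
      show "eventually (\<lambda>n. 1 / (root 3 (m n) ^ 2 * p n) \<le> 1 / (real n * root 3 (m n)) / p n) at_top"
        using p0 eventually_gt_at_top[of 0]
      proof eventually_elim
        case (elim n)
        have "real n * root 3 (m n) \<le> root 3 (m n) ^ 2"
          using root_ge[of n] root0[of n] elim by (simp add: power2_eq_square)
        then have "1 / (root 3 (m n) ^ 2 * p n) \<le> 1 / (real n * root 3 (m n) * p n)"
          using elim root0[of n] by (intro divide_left_mono mult_right_mono) auto
        then show ?case by (simp add: divide_divide_eq_left)
      qed
    qed (use p_prob in \<open>auto intro!: always_eventually\<close>)
  next
    case False
    then have \<alpha>: "3 < \<alpha>" using alpha by simp
    have lim: "(\<lambda>n. root 3 (real n ^ 3 / m n)) \<longlonglongrightarrow> 0"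
    proof -
      have "(\<lambda>n. real n powr (3 - \<alpha>)) \<longlonglongrightarrow> 0"
        using \<alpha> by real_asymp
      then have "(\<lambda>n. 2 * real n powr (3 - \<alpha>)) \<longlonglongrightarrow> 0" by (rule tendsto_mult_right_zero)
      then have "(\<lambda>n. real n ^ 3 / m n) \<longlonglongrightarrow> 0"
      proof (rule tendsto_sandwich[OF _ _ tendsto_const, rotated 2])
        show "eventually (\<lambda>n. real n ^ 3 / m n \<le> 2 * real n powr (3 - \<alpha>)) at_top"
          using eventually_ge_at_top[of 2]
        proof eventually_elim
          case (elim n)
          have "real n powr 1 \<le> real n powr \<alpha>" using elim \<alpha> by (intro powr_mono) auto
          then have "2 \<le> real n powr \<alpha>" using elim by simp
          \<comment> \<open>The floor loses less than 1, hence at most half of a number that is at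
            least 2.\<close>
          then have "real n powr \<alpha> / 2 \<le> m n" unfolding m_def[rule_format] by linarith
          then have "real n ^ 3 / m n \<le> real n ^ 3 / (real n powr \<alpha> / 2)"
            using \<open>2 \<le> real n powr \<alpha>\<close> elim by (intro divide_left_mono) auto
          also have "\<dots> = 2 * real n powr (3 - \<alpha>)"
            using elim by (simp add: powr_diff)
          finally show ?case .
        qed
      qed (auto intro!: always_eventually)
      then show ?thesis using tendsto_real_root[of _ 0 _ 3] by fastforce
    qed
    have "(\<lambda>n. 1 / c * root 3 (real n ^ 3 / m n)) \<longlonglongrightarrow> 0"
      by (rule tendsto_mult_right_zero[OF lim])
    then show ?thesis
    proof (rule tendsto_sandwich[OF _ _ tendsto_const, rotated 2])
      show "eventually (\<lambda>n. 1 / (root 3 (m n) ^ 2 * p n) \<le> 1 / c * root 3 (real n ^ 3 / m n)) at_top"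
        using lower p0
      proof eventually_elim
        case (elim n)
        have r0: "0 < root 3 (m n)" using root0 elim by simp
        have "1 / (root 3 (m n) ^ 2 * p n) \<le> 1 / (root 3 (m n) ^ 2 * (c / (real n * root 3 (m n))))"
          using elim r0 c by (intro divide_left_mono mult_left_mono) auto
        also have "\<dots> = 1 / c * (real n / root 3 (m n))"
          using r0 c elim by (simp add: field_simps power2_eq_square)
        also have "real n / root 3 (m n) = root 3 (real n ^ 3 / m n)"
          by (simp add: real_root_divide real_root_power_cancel)
        finally show ?case .
      qed
    qed (use p_prob in \<open>auto intro!: always_eventually\<close>)
  qed
  have p01: "0 \<le> p n \<and> p n \<le> 1" for n using p_prob by simp
  note q2_eps' = q2_eps[folded edge_prob_def]
  consider "increasing_property A" | "decreasing_property A"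
    using mono by (auto simp: monotone_property_def)
  then show ?thesis
  proof cases
    case 1
    show ?thesis
      by (rule rig_limit_increasing[OF p01 m3 p0 np \<kappa> _ q2_eps'])
         (use 1 in \<open>auto simp: increasing_property_def\<close>)
  next
    case 2
    \<comment> \<open>The complement is increasing, and both probabilities turn into one minus
      themselves.\<close>
    let ?B = "\<lambda>n. Pow (all_edges n) - A n"
    have "(\<lambda>n. rig_prob n (m n) (p n) (?B n)) \<longlonglongrightarrow> 1 - a"
    proof (rule rig_limit_increasing[OF p01 m3 p0 np \<kappa>])
      fix n G G' assume "G \<in> ?B n" "G \<subseteq> G'" "G' \<subseteq> all_edges n"
      then show "G' \<in> ?B n" using 2 by (auto simp: decreasing_property_def)
    next
      fix \<epsilon> :: "nat \<Rightarrow> real" assume "\<epsilon> \<longlonglongrightarrow> 0"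
      then show "(\<lambda>n. gnp_prob n ((1 + \<epsilon> n) * edge_prob n (m n) (p n)) (?B n)) \<longlonglongrightarrow> 1 - a"
        unfolding gnp_prob_compl by (intro tendsto_intros q2_eps')
    qed
    from tendsto_diff[OF tendsto_const[of 1] this[unfolded rig_prob_compl]]
    show ?thesis by simp
  qed
qed

end
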